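(* Let $a\in(0,\tfrac{2\pi}{5})$ and let $p,q\in L_2(0,\pi)$ be complex-valued functions vanishing a.e. on $(0,a)$. For $j\in\{1,2\}$ let $\{\lambda_{n,j}\}_{n\in\mathbb{Z}}$ be the eigenvalues of $\mathcal{B}_j(a,p,q)$ and let $\{\widetilde\lambda_{n,j}\}_{n\in\mathbb{Z}}$ be the eigenvalues of the problem $\mathcal{B}_j(a,0,0)$ with zero potentials, that is, $\widetilde\lambda_{n,j}=n+\frac{1-j}{2}$, $n\in\mathbb{Z}$ (eigenvalues being counted with multiplicity). If $\lambda_{n,j}=\widetilde\lambda_{n,j}$ for all $n\in\mathbb{Z}$ and $j=1,2$, then $p(x)=q(x)=0$ a.e. on $(a,\pi)$.
   Context: For $a\in(0,\pi)$ and complex-valued $p,q\in L_2(0,\pi)$ with $p=q=0$ a.e. on $(0,a)$, and $j\in\{1,2\}$, $\mathcal{B}_j(a,p,q)$ denotes the boundary value problem $$By'(x)+Q(x)y(x-a)=\lambda y(x),\quad 0<x<\pi,\qquad y_1(0)=y_j(\pi)=0,$$ where $$B=\begin{bmatrix}0&1\\ -1&0\end{bmatrix},\quad y(x)=\begin{bmatrix}y_1(x)\\ y_2(x)\end{bmatrix},\quad Q(x)=\begin{bmatrix}p(x)&q(x)\\ q(x)&-p(x)\end{bmatrix}.$$ Since $Q=0$ on $(0,a)$, the term $Q(x)y(x-a)$ is understood to be $0$ for $x<a$. Solutions are absolutely continuous on $[0,\pi]$ and satisfy the equation a.e. Let $S(x,\lambda)=\begin{bmatrix}s_1(x,\lambda)\\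 s_2(x,\lambda)\end{bmatrix}$ be the solution of the equation with $S(0,\lambda)=\begin{bmatrix}0\\ -1\end{bmatrix}$. The characteristic function of $\mathcal{B}_j(a,p,q)$ is the entire function $\Delta_j(\lambda)=s_j(\pi,\lambda)$. Its zeros are the eigenvalues of $\mathcal{B}_j(a,p,q)$, and the multiplicity of an eigenvalue is its multiplicity as a zero of $\Delta_j$. For zero potentials the characteristic functions are $\widetilde\Delta_1(\lambda)=\sin\lambda\pi$ and $\widetilde\Delta_2(\lambda)=-\cos\lambda\pi$. *)

theory Defs
  imports "HOL-Complex_Analysis.Complex_Singularities"
begin

definition absolutely_continuous_on ::
    "real set \<Rightarrow> (real \<Rightarrow> 'a::real_normed_vector) \<Rightarrow> bool" where
  "absolutely_continuous_on S f \<longleftrightarrow>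
     (\<forall>\<epsilon>>0. \<exists>\<delta>>0. \<forall>d. d division_of \<Union>d \<and> \<Union>d \<subseteq> S \<and> (\<Sum>k\<in>d. Sup k - Inf k) < \<delta> \<longrightarrow>
        (\<Sum>k\<in>d. norm (f (Sup k) - f (Inf k))) < \<epsilon>)"

definition L2_on :: "real set \<Rightarrow> (real \<Rightarrow> complex) \<Rightarrow> bool" where
  "L2_on S f \<longleftrightarrow>
     f \<in> borel_measurable (lebesgue_on S) \<and> integrable (lebesgue_on S) (\<lambda>x. (norm (f x))\<^sup>2)"

definition matB :: "complex^2^2" where
  "matB = vector [vector [0, 1], vector [-1, 0]]"

definition matQ :: "(real \<Rightarrow> complex) \<Rightarrow> (real \<Rightarrow> complex) \<Rightarrow> real \<Rightarrow> complex^2^2" where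
  "matQ p q x = vector [vector [p x, q x], vector [q x, - p x]]"

text \<open>The function \<open>y\<close> is of interest on \<open>[0, pi]\<close> only, so the delayed term is set to zero for
  \<open>x < a\<close> instead of referring to values of \<open>y\<close> at negative arguments.\<close>

definition delay_dirac_solution ::
    "real \<Rightarrow> (real \<Rightarrow> complex) \<Rightarrow> (real \<Rightarrow> complex) \<Rightarrow> complex \<Rightarrow> (real \<Rightarrow> complex^2) \<Rightarrow> bool" where
  "delay_dirac_solution a p q lam y \<longleftrightarrow>
     absolutely_continuous_on {0..pi} y \<and>
     (AE x\<in>{0<..<pi} in lebesgue.
        \<exists>y'. (y has_vector_derivative y') (at x) \<and>
             matB *v y' + (if x < a then 0 else matQ p q x *v y (x - a)) = lam *s y x)"

text \<open>Solutions of the initial value problem are unique on \<open>[0, pi]\<close> but arbitrary elsewhere, hence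
  the choice operator; only the value at \<open>pi\<close> is used below.\<close>

definition solS ::
    "real \<Rightarrow> (real \<Rightarrow> complex) \<Rightarrow> (real \<Rightarrow> complex) \<Rightarrow> complex \<Rightarrow> real \<Rightarrow> complex^2" where
  "solS a p q lam = (SOME y. delay_dirac_solution a p q lam y \<and> y 0 = vector [0, -1])"

text \<open>The index \<open>j\<close> is a number, since it also occurs in arithmetic expressions; \<open>of_nat j\<close> is the
  corresponding element of the index type \<open>2\<close> of \<open>complex^2\<close> when \<open>j\<close> is 1 or 2.\<close>

definition char_fun ::
    "nat \<Rightarrow> real \<Rightarrow> (real \<Rightarrow> complex) \<Rightarrow> (real \<Rightarrow> complex) \<Rightarrow> complex \<Rightarrow> complex" where
  "char_fun j a p q lam = solS a p q lam pi $ of_nat j"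

definition eigenvalue_mult ::
    "nat \<Rightarrow> real \<Rightarrow> (real \<Rightarrow> complex) \<Rightarrow> (real \<Rightarrow> complex) \<Rightarrow> complex \<Rightarrow> nat" where
  "eigenvalue_mult j a p q z =
     (if char_fun j a p q z = 0 then nat (zorder (char_fun j a p q) z) else 0)"

text \<open>\<open>ev\<close> lists all eigenvalues, each as often as its multiplicity says.\<close>

definition eigenvalue_sequence ::
    "nat \<Rightarrow> real \<Rightarrow> (real \<Rightarrow> complex) \<Rightarrow> (real \<Rightarrow> complex) \<Rightarrow> (int \<Rightarrow> complex) \<Rightarrow> bool" where
  "eigenvalue_sequence j a p q ev \<longleftrightarrow>
     (\<forall>z. finite {n. ev n = z} \<and> card {n. ev n = z} = eigenvalue_mult j a p q z)"

text \<open>The eigenvalues for zero potentials; this is verified at the end of the theory.\<close>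

definition free_eigenvalue :: "nat \<Rightarrow> int \<Rightarrow> complex" where
  "free_eigenvalue j n = of_int n + (1 - of_nat j) / 2"

text \<open>The rest of the theory computes the spectrum for zero potentials from the definitions
  above.\<close>

lemma absolutely_continuous_onD:
  assumes "absolutely_continuous_on S f" "0 < e"
  obtains d where "0 < d"
    "\<And>D. D division_of \<Union>D \<Longrightarrow> \<Union>D \<subseteq> S \<Longrightarrow> (\<Sum>k\<in>D. Sup k - Inf k) < d \<Longrightarrow>
       (\<Sum>k\<in>D. norm (f (Sup k) - f (Inf k))) < e"
  using assms unfolding absolutely_continuous_on_def by meson

lemma division_real_piece:
  assumes "D division_of \<Union>D" "k \<in> D"
  obtains u v :: real where "k = {u..v}" "u \<le> v"
  by (metis assms box_real(2) division_ofD(3,4) atLeastatMost_empty_iff)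

lemma tagged_real_piece:
  assumes "p tagged_division_of {a..b::real}" "(x,k) \<in> p"
  obtains u v :: real where "k = {u..v}" "u \<le> x" "x \<le> v" "a \<le> u" "v \<le> b"
proof -
  obtain u v where "k = cbox u v" using assms tagged_division_ofD(4) by metis
  moreover have "x \<in> k" "k \<subseteq> {a..b}" using assms tagged_division_ofD(2,3) by metis+
  ultimately show ?thesis using that[of u v] by auto
qed

lemma absolutely_continuous_on_zero_deriv:
  fixes f :: "real \<Rightarrow> 'a::real_normed_vector"
  assumes ac: "absolutely_continuous_on {a..b} f" and ab: "a \<le> b"
    and ae: "AE x\<in>{a<..<b} in lebesgue. (f has_vector_derivative 0) (at x)"
  shows "f b = f a"
proof -
  have bound: "norm (f b - f a) \<le> e * (b - a) + e" if e: "0 < e" for e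
  proof -
    obtain d where d: "0 < d" and D: "\<And>D. D division_of \<Union>D \<Longrightarrow> \<Union>D \<subseteq> {a..b} \<Longrightarrow>
        (\<Sum>k\<in>D. Sup k - Inf k) < d \<Longrightarrow> (\<Sum>k\<in>D. norm (f (Sup k) - f (Inf k))) < e"
      by (rule absolutely_continuous_onD[OF ac e]) blast
    obtain N0 where N0: "{x \<in> space lebesgue. \<not> (x \<in> {a<..<b} \<longrightarrow> (f has_vector_derivative 0) (at x))} \<subseteq> N0"
        "emeasure lebesgue N0 = 0" "N0 \<in> sets lebesgue"
      using ae by (rule AE_E)
    define N where "N = N0 \<union> {a,b}"
    have fn: "{a,b} \<in> null_sets lebesgue"
      by (simp add: negligible_finite flip: negligible_iff_null_sets)
    have "N0 \<in> null_sets lebesgue" using N0(2,3) by (rule null_setsI)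
    then have Nn: "N \<in> null_sets lebesgue"
      unfolding N_def using fn by (rule null_sets.Un)
    then have Ns: "N \<in> sets lebesgue" by auto
    obtain U where U: "open U" "N \<subseteq> U" "U - N \<in> lmeasurable" "emeasure lebesgue (U - N) < ennreal d"
      using sets_lebesgue_outer_open[OF Ns d] by blast
    have Us: "U \<in> sets lebesgue" using U(1) by auto
    have emU: "emeasure lebesgue U < ennreal d"
      using emeasure_Diff_null_set[OF Nn Us] U(4) by simp
    have good: "\<exists>r>0. \<forall>y. \<bar>y - x\<bar> < r \<longrightarrow> norm (f y - f x) \<le> e * \<bar>y - x\<bar>"
      if "x \<in> {a..b}" "x \<notin> N" for x
    proof -
      have "(f has_vector_derivative 0) (at x)"
      proof -
        have "x \<in> {a<..<b}" "x \<notin> N0" using that by (auto simp: N_def)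
        then show ?thesis using N0(1) by auto
      qed
      then have "(f has_derivative (\<lambda>h. 0)) (at x)"
        by (simp add: has_vector_derivative_def)
      then show ?thesis
        using e by (auto simp: has_derivative_at_alt)
    qed
    have "\<exists>r. \<forall>x. 0 < r x \<and> (x \<in> N \<longrightarrow> ball x (r x) \<subseteq> U) \<and>
       (x \<in> {a..b} - N \<longrightarrow> (\<forall>y. \<bar>y - x\<bar> < r x \<longrightarrow> norm (f y - f x) \<le> e * \<bar>y - x\<bar>))"
    proof (intro choice allI)
      fix x
      consider "x \<in> N" | "x \<in> {a..b} - N" | "x \<notin> {a..b}" "x \<notin> N" by blast
      then show "\<exists>r>0. (x \<in> N \<longrightarrow> ball x r \<subseteq> U) \<and>
       (x \<in> {a..b} - N \<longrightarrow> (\<forall>y. \<bar>y - x\<bar> < r \<longrightarrow> norm (f y - f x) \<le> e * \<bar>y - x\<bar>))"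
      proof cases
        case 1 then show ?thesis using U(1,2) by (metis DiffD2 openE subsetD)
      next
        case 2 then show ?thesis using good by auto
      next
        case 3 then show ?thesis by (auto intro: exI[of _ 1])
      qed
    qed
    then obtain r where r: "\<And>x. 0 < r x" "\<And>x. x \<in> N \<Longrightarrow> ball x (r x) \<subseteq> U"
      "\<And>x y. x \<in> {a..b} - N \<Longrightarrow> \<bar>y - x\<bar> < r x \<Longrightarrow> norm (f y - f x) \<le> e * \<bar>y - x\<bar>"
      by blast
    have "gauge (\<lambda>x. ball x (r x))" using r(1) by (auto simp: gauge_def)
    then obtain P where P: "P tagged_division_of {a..b}" "(\<lambda>x. ball x (r x)) fine P"
      using fine_division_exists_real by blast
    have finP: "finite P" using P(1) by blast
    define B where "B = {(x,k) \<in> P. x \<in> N}"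
    have BP: "B \<subseteq> P" by (auto simp: B_def)
    have fin: "finite B" "finite (P - B)" using finP BP finite_subset by auto
    have tpB: "B tagged_partial_division_of {a..b}"
      using P(1) BP tagged_partial_division_subset tagged_division_of_def by blast
    have tB: "B tagged_division_of \<Union>(snd ` B)"
      using tagged_partial_division_of_Union_self[OF tpB] .
    have dB: "snd ` B division_of \<Union>(snd ` B)"
      using division_of_tagged_division[OF tB] .
    have sub: "\<Union>(snd ` B) \<subseteq> {a..b}"
      using tagged_partial_division_ofD(3)[OF tpB] by force
    have kU: "k \<subseteq> U" if "k \<in> snd ` B" for k
    proof -
      obtain x where x: "(x,k) \<in> P" "x \<in> N" using \<open>k \<in> snd ` B\<close> by (auto simp: B_def)
      then show ?thesis using P(2) r(2)[of x] unfolding fine_def by blast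
    qed
    have SI: "Sup k - Inf k = measure lebesgue k" if "k \<in> snd ` B" for k
      by (rule division_real_piece[OF dB that]) auto
    have "(\<Sum>k\<in>snd ` B. Sup k - Inf k) = (\<Sum>k\<in>snd ` B. measure lebesgue k)"
      using SI by (rule sum.cong[OF refl])
    also have "\<dots> = measure lebesgue (\<Union>(snd ` B))"
      using content_division[OF dB] .
    also have "\<dots> < d"
    proof -
      have "emeasure lebesgue (\<Union>(snd ` B)) \<le> emeasure lebesgue U"
        using kU Us by (intro emeasure_mono) auto
      then have "emeasure lebesgue (\<Union>(snd ` B)) < ennreal d" using emU by order
      moreover from this have "emeasure lebesgue (\<Union>(snd ` B)) \<noteq> top" by auto
      ultimately show ?thesis using d by (metis emeasure_eq_ennreal_measure ennreal_less_iff measure_nonneg)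
    qed
    finally have bad: "(\<Sum>k\<in>snd ` B. norm (f (Sup k) - f (Inf k))) < e"
      using D dB sub by blast
    have badP: "(\<Sum>(x,k)\<in>B. norm (f (Sup k) - f (Inf k))) = (\<Sum>k\<in>snd ` B. norm (f (Sup k) - f (Inf k)))"
    proof -
      define g where "g = (\<lambda>k. if k = {} then 0 else norm (f (Sup k) - f (Inf k)))"
      have "(\<Sum>(x,k)\<in>B. g k) = (\<Sum>k\<in>snd ` B. g k)"
        by (rule sum.over_tagged_division_lemma[OF tB])
          (auto simp: g_def)
      moreover have g: "g k = norm (f (Sup k) - f (Inf k))" if "k \<in> snd ` B" for k
        using that dB by (auto simp: g_def)
      ultimately show ?thesis by (simp add: case_prod_unfold)
    qed
    have gP: "norm (f (Sup k) - f (Inf k)) \<le> e * (Sup k - Inf k)" if "(x,k) \<in> P - B" for x k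
    proof -
      have xk: "(x,k) \<in> P" using that by auto
      obtain u v where uv: "k = {u..v}" "u \<le> x" "x \<le> v" "a \<le> u" "v \<le> b"
        using tagged_real_piece[OF P(1) xk] .
      have x: "x \<in> {a..b} - N" using that uv by (auto simp: B_def)
      have "k \<subseteq> ball x (r x)" using P(2) that unfolding fine_def by blast
      moreover have "u \<in> k" "v \<in> k" using uv by auto
      ultimately have "u \<in> ball x (r x)" "v \<in> ball x (r x)" by blast+
      then have "norm (f u - f x) \<le> e * (x - u)" "norm (f v - f x) \<le> e * (v - x)"
        using r(3)[OF x, of u] r(3)[OF x, of v] uv by (auto simp: dist_real_def abs_minus_commute)
      moreover have "norm (f v - f u) \<le> norm (f v - f x) + norm (f u - f x)"
        by (metis norm_triangle_ineq4 diff_diff_eq2 diff_add_cancel diff_add_eq)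
      ultimately show ?thesis using uv by (simp add: algebra_simps)
    qed
    have "f b - f a = (\<Sum>(x,K)\<in>P. f (Sup K) - f (Inf K))"
      using additive_tagged_division_1[OF ab P(1), of f] by simp
    then have "norm (f b - f a) \<le> (\<Sum>(x,K)\<in>P. norm (f (Sup K) - f (Inf K)))"
      by (simp add: case_prod_unfold sum_norm_le)
    also have "\<dots> = (\<Sum>(x,K)\<in>P - B. norm (f (Sup K) - f (Inf K))) + (\<Sum>(x,K)\<in>B. norm (f (Sup K) - f (Inf K)))"
      by (rule sum.subset_diff[OF BP finP])
    also have "(\<Sum>(x,K)\<in>P - B. norm (f (Sup K) - f (Inf K))) \<le> (\<Sum>(x,K)\<in>P - B. e * (Sup K - Inf K))"
      using gP by (intro sum_mono) auto
    also have "\<dots> \<le> (\<Sum>(x,K)\<in>P. e * (Sup K - Inf K))"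
    proof (rule sum_mono2[OF finP])
      fix z assume "z \<in> P - (P - B)"
      then obtain x k where z: "z = (x,k)" "(x,k) \<in> P" by (cases z) auto
      obtain u v where "k = {u..v}" "u \<le> x" "x \<le> v"
        using tagged_real_piece[OF P(1) z(2)] by blast
      then show "0 \<le> (case z of (x,K) \<Rightarrow> e * (Sup K - Inf K))" using e z by auto
    qed auto
    also have "\<dots> = e * (b - a)"
      using additive_tagged_division_1[OF ab P(1), of "\<lambda>x. x"]
      by (simp add: sum_distrib_left case_prod_unfold flip: sum_distrib_left)
    finally show ?thesis using bad badP by simp
  qed
  then have *: "norm (f b - f a) \<le> e * (b - a + 1)" if "0 < e" for e
    using bound[OF that] by (simp add: algebra_simps)
  have "norm (f b - f a) \<le> 0"
  proof (rule field_le_epsilon)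
    fix e :: real assume "0 < e"
    then show "norm (f b - f a) \<le> 0 + e"
      using *[of "e / (b - a + 1)"] ab by simp
  qed
  then show ?thesis by simp
qed

lemma absolutely_continuous_on_lipschitz:
  assumes "\<And>u v. u \<in> S \<Longrightarrow> v \<in> S \<Longrightarrow> norm (f v - f u) \<le> L * \<bar>v - u\<bar>"
  shows "absolutely_continuous_on S f"
  unfolding absolutely_continuous_on_def
proof (intro allI impI)
  fix e :: real assume e: "0 < e"
  define M where "M = \<bar>L\<bar> + 1"
  have M: "0 < M" "L \<le> M" by (auto simp: M_def)
  show "\<exists>d>0. \<forall>D. D division_of \<Union>D \<and> \<Union>D \<subseteq> S \<and> (\<Sum>k\<in>D. Sup k - Inf k) < d \<longrightarrow>
     (\<Sum>k\<in>D. norm (f (Sup k) - f (Inf k))) < e"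
  proof (intro exI[of _ "e / M"] conjI allI impI; (elim conjE)?)
    show "0 < e / M" using e M by simp
    fix D :: "real set set"
    assume D: "D division_of \<Union>D" "\<Union>D \<subseteq> S" "(\<Sum>k\<in>D. Sup k - Inf k) < e / M"
    have "(\<Sum>k\<in>D. norm (f (Sup k) - f (Inf k))) \<le> (\<Sum>k\<in>D. M * (Sup k - Inf k))"
    proof (rule sum_mono)
      fix k assume k: "k \<in> D"
      obtain u v where uv: "k = {u..v}" "u \<le> v" using division_real_piece[OF D(1) k] .
      then have "u \<in> \<Union>D" "v \<in> \<Union>D" using k by auto
      then have "norm (f v - f u) \<le> L * \<bar>v - u\<bar>" using D(2) by (intro assms) auto
      also have "\<dots> \<le> M * (v - u)" using uv M by (simp add: mult_right_mono)
      finally show "norm (f (Sup k) - f (Inf k)) \<le> M * (Sup k - Inf k)" using uv by simp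
    qed
    also have "\<dots> = M * (\<Sum>k\<in>D. Sup k - Inf k)" by (simp add: sum_distrib_left)
    also have "\<dots> < e" using D(3) M by (simp add: field_simps)
    finally show "(\<Sum>k\<in>D. norm (f (Sup k) - f (Inf k))) < e" .
  qed
qed


lemma absolutely_continuous_on_dominated:
  assumes "absolutely_continuous_on S f"
    and "\<And>u v. u \<in> S \<Longrightarrow> v \<in> S \<Longrightarrow> norm (g v - g u) \<le> norm (f v - f u)"
  shows "absolutely_continuous_on S g"
  unfolding absolutely_continuous_on_def
proof (intro allI impI)
  fix e :: real assume e: "0 < e"
  obtain d where d: "0 < d" and D: "\<And>D. D division_of \<Union>D \<Longrightarrow> \<Union>D \<subseteq> S \<Longrightarrow>
        (\<Sum>k\<in>D. Sup k - Inf k) < d \<Longrightarrow> (\<Sum>k\<in>D. norm (f (Sup k) - f (Inf k))) < e"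
    by (rule absolutely_continuous_onD[OF assms(1) e]) blast
  have "(\<Sum>k\<in>E. norm (g (Sup k) - g (Inf k))) < e"
    if E: "E division_of \<Union>E" "\<Union>E \<subseteq> S" "(\<Sum>k\<in>E. Sup k - Inf k) < d" for E
  proof -
    have "(\<Sum>k\<in>E. norm (g (Sup k) - g (Inf k))) \<le> (\<Sum>k\<in>E. norm (f (Sup k) - f (Inf k)))"
    proof (rule sum_mono)
      fix k assume k: "k \<in> E"
      obtain u v where uv: "k = {u..v}" "u \<le> v" using division_real_piece[OF E(1) k] .
      then have "u \<in> \<Union>E" "v \<in> \<Union>E" using k by auto
      then have "norm (g v - g u) \<le> norm (f v - f u)" using E(2) by (intro assms(2)) auto
      then show "norm (g (Sup k) - g (Inf k)) \<le> norm (f (Sup k) - f (Inf k))" using uv by simp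
    qed
    also have "\<dots> < e" using D E by blast
    finally show ?thesis .
  qed
  then show "\<exists>d>0. \<forall>D. D division_of \<Union>D \<and> \<Union>D \<subseteq> S \<and> (\<Sum>k\<in>D. Sup k - Inf k) < d \<longrightarrow>
     (\<Sum>k\<in>D. norm (g (Sup k) - g (Inf k))) < e"
    using d by blast
qed

lemma absolutely_continuous_on_dominated2:
  assumes f: "absolutely_continuous_on S f" and g: "absolutely_continuous_on S g" and C: "0 < C"
    and le: "\<And>u v. u \<in> S \<Longrightarrow> v \<in> S \<Longrightarrow>
       norm (h v - h u) \<le> C * norm (f v - f u) + C * norm (g v - g u)"
  shows "absolutely_continuous_on S h"
  unfolding absolutely_continuous_on_def
proof (intro allI impI)
  fix e :: real assume e: "0 < e"
  have e': "0 < e / (2 * C)" using e C by simp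
  obtain d1 where d1: "0 < d1" and D1: "\<And>D. D division_of \<Union>D \<Longrightarrow> \<Union>D \<subseteq> S \<Longrightarrow>
        (\<Sum>k\<in>D. Sup k - Inf k) < d1 \<Longrightarrow> (\<Sum>k\<in>D. norm (f (Sup k) - f (Inf k))) < e / (2 * C)"
    by (rule absolutely_continuous_onD[OF f e']) blast
  obtain d2 where d2: "0 < d2" and D2: "\<And>D. D division_of \<Union>D \<Longrightarrow> \<Union>D \<subseteq> S \<Longrightarrow>
        (\<Sum>k\<in>D. Sup k - Inf k) < d2 \<Longrightarrow> (\<Sum>k\<in>D. norm (g (Sup k) - g (Inf k))) < e / (2 * C)"
    by (rule absolutely_continuous_onD[OF g e']) blast
  have "(\<Sum>k\<in>E. norm (h (Sup k) - h (Inf k))) < e"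
    if E: "E division_of \<Union>E" "\<Union>E \<subseteq> S" "(\<Sum>k\<in>E. Sup k - Inf k) < min d1 d2" for E
  proof -
    have "(\<Sum>k\<in>E. norm (h (Sup k) - h (Inf k))) \<le>
        (\<Sum>k\<in>E. C * norm (f (Sup k) - f (Inf k)) + C * norm (g (Sup k) - g (Inf k)))"
    proof (rule sum_mono)
      fix k assume k: "k \<in> E"
      obtain u v where uv: "k = {u..v}" "u \<le> v" using division_real_piece[OF E(1) k] .
      then have "u \<in> \<Union>E" "v \<in> \<Union>E" using k by auto
      then have "norm (h v - h u) \<le> C * norm (f v - f u) + C * norm (g v - g u)"
        using E(2) by (intro le) auto
      then show "norm (h (Sup k) - h (Inf k)) \<le>
          C * norm (f (Sup k) - f (Inf k)) + C * norm (g (Sup k) - g (Inf k))" using uv by simp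
    qed
    also have "\<dots> = C * (\<Sum>k\<in>E. norm (f (Sup k) - f (Inf k))) +
        C * (\<Sum>k\<in>E. norm (g (Sup k) - g (Inf k)))"
      by (simp add: sum.distrib sum_distrib_left)
    also have "\<dots> < C * (e / (2 * C)) + C * (e / (2 * C))"
      using E by (intro add_strict_mono mult_strict_left_mono C D1 D2) auto
    also have "\<dots> = e" using C by (simp add: field_simps)
    finally show ?thesis .
  qed
  then show "\<exists>d>0. \<forall>D. D division_of \<Union>D \<and> \<Union>D \<subseteq> S \<and> (\<Sum>k\<in>D. Sup k - Inf k) < d \<longrightarrow>
     (\<Sum>k\<in>D. norm (h (Sup k) - h (Inf k))) < e"
    using d1 d2 by (intro exI[of _ "min d1 d2"]) auto
qed

lemma absolutely_continuous_on_imp_continuous_on: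
  assumes "absolutely_continuous_on {a..b} f"
  shows "continuous_on {a..b} f"
  unfolding continuous_on_iff
proof (intro ballI allI impI)
  fix x e :: real assume x: "x \<in> {a..b}" and e: "0 < e"
  obtain d where d: "0 < d" and D: "\<And>D. D division_of \<Union>D \<Longrightarrow> \<Union>D \<subseteq> {a..b} \<Longrightarrow>
        (\<Sum>k\<in>D. Sup k - Inf k) < d \<Longrightarrow> (\<Sum>k\<in>D. norm (f (Sup k) - f (Inf k))) < e"
    by (rule absolutely_continuous_onD[OF assms e]) blast
  have main: "norm (f v - f u) < e" if "u \<in> {a..b}" "v \<in> {a..b}" "u \<le> v" "v - u < d" for u v
  proof -
    have "{{u..v}} division_of \<Union>{{u..v}}"
      using division_of_self[of u v] that by simp
    then show ?thesis using D[of "{{u..v}}"] that by auto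
  qed
  show "\<exists>d>0. \<forall>y\<in>{a..b}. dist y x < d \<longrightarrow> dist (f y) (f x) < e"
  proof (intro exI[of _ d] conjI ballI impI d)
    fix y assume y: "y \<in> {a..b}" "dist y x < d"
    show "dist (f y) (f x) < e"
    proof (cases "y \<le> x")
      case True then show ?thesis using main[of y x] x y by (simp add: dist_norm norm_minus_commute)
    next
      case False then show ?thesis using main[of x y] x y by (simp add: dist_norm)
    qed
  qed
qed

lemma absolutely_continuous_on_add:
  assumes "absolutely_continuous_on S f" "absolutely_continuous_on S g"
  shows "absolutely_continuous_on S (\<lambda>x. f x + g x)"
  by (rule absolutely_continuous_on_dominated2[OF assms, of 1])
    (auto simp: add_diff_add norm_triangle_ineq)

lemma absolutely_continuous_on_mult:
  fixes f g :: "real \<Rightarrow> complex"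
  assumes f: "absolutely_continuous_on {a..b} f" and g: "absolutely_continuous_on {a..b} g"
  shows "absolutely_continuous_on {a..b} (\<lambda>x. f x * g x)"
proof -
  have "bounded (f ` {a..b})" "bounded (g ` {a..b})"
    using f g by (auto intro!: compact_imp_bounded compact_continuous_image
        absolutely_continuous_on_imp_continuous_on)
  then obtain F G where F: "0 < F" "\<And>x. x \<in> {a..b} \<Longrightarrow> norm (f x) \<le> F"
    and G: "0 < G" "\<And>x. x \<in> {a..b} \<Longrightarrow> norm (g x) \<le> G"
    by (auto simp: bounded_pos)
  show ?thesis
  proof (rule absolutely_continuous_on_dominated2[OF f g, of "max F G"])
    fix u v assume uv: "u \<in> {a..b}" "v \<in> {a..b}"
    have "f v * g v - f u * g u = g v * (f v - f u) + f u * (g v - g u)" by algebra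
    then have "norm (f v * g v - f u * g u) \<le> norm (g v) * norm (f v - f u) + norm (f u) * norm (g v - g u)"
      by (metis norm_mult norm_triangle_ineq)
    also have "\<dots> \<le> max F G * norm (f v - f u) + max F G * norm (g v - g u)"
      using F(2)[OF uv(1)] G(2)[OF uv(2)] by (intro add_mono mult_right_mono) auto
    finally show "norm (f v * g v - f u * g u) \<le> max F G * norm (f v - f u) + max F G * norm (g v - g u)" .
  qed (use F in auto)
qed

lemma absolutely_continuous_on_C1:
  fixes f f' :: "real \<Rightarrow> 'a::euclidean_space"
  assumes d: "\<And>x. (f has_vector_derivative f' x) (at x)" and c: "continuous_on {a..b} f'"
  shows "absolutely_continuous_on {a..b} f"
proof -
  have "bounded (f' ` {a..b})" using c by (intro compact_imp_bounded compact_continuous_image) auto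
  then obtain L where L: "0 < L" "\<And>x. x \<in> {a..b} \<Longrightarrow> norm (f' x) \<le> L"
    by (auto simp: bounded_pos)
  show ?thesis
  proof (rule absolutely_continuous_on_lipschitz[of _ _ L])
    fix u v assume uv: "u \<in> {a..b}" "v \<in> {a..b}"
    have "norm (f v - f u) \<le> L * norm (v - u)"
    proof (rule differentiable_bound[of "{a..b}" f "\<lambda>x h. h *\<^sub>R f' x"])
      fix x assume x: "x \<in> {a..b}"
      show "(f has_derivative (\<lambda>h. h *\<^sub>R f' x)) (at x within {a..b})"
        using d by (simp add: has_vector_derivative_def has_derivative_at_withinI)
      show "onorm (\<lambda>h. h *\<^sub>R f' x) \<le> L"
        using mult_right_mono[OF L(2)[OF x] abs_ge_zero] by (intro onorm_le) (simp add: mult.commute)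
    qed (use uv in auto)
    then show "norm (f v - f u) \<le> L * \<bar>v - u\<bar>" by simp
  qed
qed

lemma complex_trig_vector_derivs:
  "((\<lambda>x. sin (lam * complex_of_real x)) has_vector_derivative lam * cos (lam * of_real x)) (at x)"
  "((\<lambda>x. cos (lam * complex_of_real x)) has_vector_derivative - lam * sin (lam * of_real x)) (at x)"
  by (rule has_vector_derivative_real_field, auto intro!: derivative_eq_intros)+

lemma trig_absolutely_continuous_on:
  "absolutely_continuous_on {a..b} (\<lambda>x. sin (lam * complex_of_real x))"
  "absolutely_continuous_on {a..b} (\<lambda>x. cos (lam * complex_of_real x))"
  by (rule absolutely_continuous_on_C1, rule complex_trig_vector_derivs, intro continuous_intros)+

lemma has_vector_derivative_vec2:
  fixes y :: "real \<Rightarrow> complex^2"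
  shows "(y has_vector_derivative y') (at x) \<longleftrightarrow>
    ((\<lambda>x. y x $ 1) has_vector_derivative y' $ 1) (at x) \<and>
    ((\<lambda>x. y x $ 2) has_vector_derivative y' $ 2) (at x)"
  unfolding has_vector_derivative_def
    has_derivative_componentwise_within[of y] has_derivative_componentwise_within[of "\<lambda>x. y x $ _"]
  by (auto simp: Basis_vec_def inner_axis forall_2)

lemma free_equation_iff:
  "matB *v y' + (if x < a then 0 else matQ (\<lambda>_. 0) (\<lambda>_. 0) x *v z) = lam *s y \<longleftrightarrow>
     y' $ 2 = lam * y $ 1 \<and> - (y' $ 1) = lam * y $ 2"
  by (auto simp: matB_def matQ_def vec_eq_iff forall_2 matrix_vector_mult_def sum_2)

lemma free_solution:
  "delay_dirac_solution a (\<lambda>_. 0) (\<lambda>_. 0) lam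
     (\<lambda>x. vector [sin (lam * of_real x), - cos (lam * of_real x)])"
  (is "delay_dirac_solution _ _ _ _ ?y")
proof -
  have d: "(?y has_vector_derivative vector [lam * cos (lam * of_real x), lam * sin (lam * of_real x)]) (at x)" for x
    using complex_trig_vector_derivs[of lam x]
    by (auto simp: has_vector_derivative_vec2 intro!: derivative_eq_intros)
  have "absolutely_continuous_on {0..pi} ?y"
  proof (rule absolutely_continuous_on_C1[OF d])
    have "continuous_on {0..pi} (\<lambda>x. \<chi> i. (vector [lam * cos (lam * of_real x), lam * sin (lam * of_real x)] :: complex^2) $ i)"
      by (intro continuous_on_vec_lambda, rename_tac i, case_tac i rule: exhaust_2[THEN disjE])
        (auto intro!: continuous_intros)
    then show "continuous_on {0..pi} (\<lambda>x. vector [lam * cos (lam * of_real x), lam * sin (lam * of_real x)] :: complex^2)"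
      by simp
  qed
  then show ?thesis
    unfolding delay_dirac_solution_def free_equation_iff
    by (intro conjI AE_I2 impI exI[of _ "vector [lam * cos (lam * of_real _), lam * sin (lam * of_real _)]"])
      (rule d | simp)+
qed

lemma free_solution_unique:
  assumes y: "delay_dirac_solution a (\<lambda>_. 0) (\<lambda>_. 0) lam y" and y0: "y 0 = vector [0, -1]"
  shows "y pi = vector [sin (lam * of_real pi), - cos (lam * of_real pi)]"
proof -
  let ?s = "\<lambda>x. sin (lam * complex_of_real x)" and ?c = "\<lambda>x. cos (lam * complex_of_real x)"
  let ?ms = "\<lambda>x. - sin (lam * complex_of_real x)"
  have ac: "absolutely_continuous_on {0..pi} y"
    and ae: "AE x\<in>{0<..<pi} in lebesgue. \<exists>y'. (y has_vector_derivative y') (at x) \<and>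
        y' $ 2 = lam * y x $ 1 \<and> - (y' $ 1) = lam * y x $ 2"
    using y by (auto simp: delay_dirac_solution_def free_equation_iff)
  have aci: "absolutely_continuous_on {0..pi} (\<lambda>x. y x $ i)" for i
    by (rule absolutely_continuous_on_dominated[OF ac])
      (simp add: Finite_Cartesian_Product.norm_nth_le flip: vector_minus_component)
  have ms: "absolutely_continuous_on {0..pi} ?ms"
    by (rule absolutely_continuous_on_dominated[OF trig_absolutely_continuous_on(1)[of _ _ lam]])
      (simp add: norm_minus_commute)
  have d: "((\<lambda>x. ?c x * y x $ 1 + ?s x * y x $ 2) has_vector_derivative 0) (at x) \<and>
      ((\<lambda>x. ?ms x * y x $ 1 + ?c x * y x $ 2) has_vector_derivative 0) (at x)"
    if h: "\<exists>y'. (y has_vector_derivative y') (at x) \<and> y' $ 2 = lam * y x $ 1 \<and> - (y' $ 1) = lam * y x $ 2"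
    for x
  proof -
    obtain y' where y': "(y has_vector_derivative y') (at x)" and e: "y' $ 2 = lam * y x $ 1" "- (y' $ 1) = lam * y x $ 2"
      using h by blast
    have e': "y' $ 1 = - lam * y x $ 2" using e(2)[symmetric] by simp
    have dy: "((\<lambda>x. y x $ 1) has_vector_derivative - lam * y x $ 2) (at x)"
      "((\<lambda>x. y x $ 2) has_vector_derivative lam * y x $ 1) (at x)"
      using y' unfolding has_vector_derivative_vec2 e(1) e' by blast+
    note dd = complex_trig_vector_derivs[of lam x]
    show ?thesis
    proof
      show "((\<lambda>x. ?c x * y x $ 1 + ?s x * y x $ 2) has_vector_derivative 0) (at x)"
        by (rule has_vector_derivative_eq_rhs[OF has_vector_derivative_add[OF
              has_vector_derivative_mult[OF dd(2) dy(1)] has_vector_derivative_mult[OF dd(1) dy(2)]]])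
          (simp add: algebra_simps)
      show "((\<lambda>x. ?ms x * y x $ 1 + ?c x * y x $ 2) has_vector_derivative 0) (at x)"
        by (rule has_vector_derivative_eq_rhs[OF has_vector_derivative_add[OF
              has_vector_derivative_mult[OF has_vector_derivative_minus[OF dd(1)] dy(1)]
              has_vector_derivative_mult[OF dd(2) dy(2)]]])
          (simp add: algebra_simps)
    qed
  qed
  have "?c pi * y pi $ 1 + ?s pi * y pi $ 2 = ?c 0 * y 0 $ 1 + ?s 0 * y 0 $ 2"
  proof (rule absolutely_continuous_on_zero_deriv[where f = "\<lambda>x. ?c x * y x $ 1 + ?s x * y x $ 2"])
    show "absolutely_continuous_on {0..pi} (\<lambda>x. ?c x * y x $ 1 + ?s x * y x $ 2)"
      by (intro absolutely_continuous_on_add absolutely_continuous_on_mult aci ms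
         trig_absolutely_continuous_on)
    show "AE x\<in>{0<..<pi} in lebesgue.
        ((\<lambda>x. ?c x * y x $ 1 + ?s x * y x $ 2) has_vector_derivative 0) (at x)"
      using ae by (rule eventually_mono) (use d in blast)
  qed simp
  moreover have "?ms pi * y pi $ 1 + ?c pi * y pi $ 2 = ?ms 0 * y 0 $ 1 + ?c 0 * y 0 $ 2"
  proof (rule absolutely_continuous_on_zero_deriv[where f = "\<lambda>x. ?ms x * y x $ 1 + ?c x * y x $ 2"])
    show "absolutely_continuous_on {0..pi} (\<lambda>x. ?ms x * y x $ 1 + ?c x * y x $ 2)"
      by (intro absolutely_continuous_on_add absolutely_continuous_on_mult aci ms
         trig_absolutely_continuous_on)
    show "AE x\<in>{0<..<pi} in lebesgue.
        ((\<lambda>x. ?ms x * y x $ 1 + ?c x * y x $ 2) has_vector_derivative 0) (at x)"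
      using ae by (rule eventually_mono) (use d in blast)
  qed simp
  ultimately have 1: "?c pi * y pi $ 1 + ?s pi * y pi $ 2 = 0" and 2: "?c pi * y pi $ 2 - ?s pi * y pi $ 1 = -1"
    using y0 by auto
  have 3: "?s pi ^ 2 + ?c pi ^ 2 = 1" by simp
  have "u = s \<and> v = - c" if "s * s + c * c = 1" "c * u + s * v = 0" "c * v - s * u = -1"
    for s c u v :: complex
  proof -
    have uv: "u = (s * s + c * c) * u" "v = (s * s + c * c) * v" using that(1) by simp_all
    have "(s * s + c * c) * u = c * (c * u + s * v) - s * (c * v - s * u)"
      "(s * s + c * c) * v = s * (c * u + s * v) + c * (c * v - s * u)"
      by (simp_all add: algebra_simps)
    with uv show ?thesis using that(2,3) by simp
  qed
  from this[OF _ 1 2] have y1: "y pi $ 1 = ?s pi" and y2: "y pi $ 2 = - ?c pi"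
    using 3 by (simp_all add: power2_eq_square)
  show ?thesis using y1 y2 by (simp add: vec_eq_iff forall_2)
qed

lemma free_char_fun:
  "char_fun 1 a (\<lambda>_. 0) (\<lambda>_. 0) lam = sin (lam * of_real pi)"
  "char_fun 2 a (\<lambda>_. 0) (\<lambda>_. 0) lam = - cos (lam * of_real pi)"
proof -
  let ?P = "\<lambda>y. delay_dirac_solution a (\<lambda>_. 0) (\<lambda>_. 0) lam y \<and> y 0 = vector [0, -1]"
  have "?P (\<lambda>x. vector [sin (lam * of_real x), - cos (lam * of_real x)])"
    using free_solution[of a lam] by simp
  then have "\<exists>y. ?P y" by (rule exI[of ?P])
  then have "?P (solS a (\<lambda>_. 0) (\<lambda>_. 0) lam)" unfolding solS_def by (rule someI_ex)
  then have "solS a (\<lambda>_. 0) (\<lambda>_. 0) lam pi = vector [sin (lam * of_real pi), - cos (lam * of_real pi)]"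
    using free_solution_unique by blast
  then show "char_fun 1 a (\<lambda>_. 0) (\<lambda>_. 0) lam = sin (lam * of_real pi)"
    "char_fun 2 a (\<lambda>_. 0) (\<lambda>_. 0) lam = - cos (lam * of_real pi)"
    by (simp_all add: char_fun_def)
qed

lemma zorder_simple:
  assumes "\<And>z. (f has_field_derivative f' z) (at z)" "f z = 0" "f' z \<noteq> 0"
  shows "zorder f z = 1"
proof (rule zorder_zero_eqI[of f UNIV])
  show "f holomorphic_on UNIV" using assms(1) by (auto simp: holomorphic_on_def field_differentiable_def)
  have "deriv f z = f' z" by (rule DERIV_imp_deriv[OF assms(1)])
  then show "(deriv ^^ nat 1) f z \<noteq> 0" using assms(3) by simp
qed (use assms in auto)

lemma free_eigenvalue_sequence:
  assumes "j \<in> {1, 2}"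
  shows "eigenvalue_sequence j a (\<lambda>_. 0) (\<lambda>_. 0) (free_eigenvalue j)"
proof -
  let ?\<Delta> = "char_fun j a (\<lambda>_. 0) (\<lambda>_. 0)"
  have zero: "?\<Delta> z = 0 \<longleftrightarrow> z \<in> range (free_eigenvalue j)" for z
  proof (cases "j = 1")
    case True
    have "?\<Delta> z = 0 \<longleftrightarrow> (\<exists>n::int. z * of_real pi = of_int n * of_real pi)"
      using True by (simp add: free_char_fun[unfolded One_nat_def] sin_eq_0)
    also have "\<dots> \<longleftrightarrow> z \<in> range (free_eigenvalue j)"
      using True by (auto simp: free_eigenvalue_def)
    finally show ?thesis .
  next
    case False
    have *: "z * of_real pi = of_int n * of_real pi + of_real pi / 2 \<longleftrightarrow> z = free_eigenvalue j (n + 1)" for n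
    proof -
      have "of_int n * of_real pi + of_real pi / 2 = free_eigenvalue j (n + 1) * of_real pi"
        using False assms by (simp add: free_eigenvalue_def field_simps)
      then show ?thesis by simp
    qed
    have "?\<Delta> z = 0 \<longleftrightarrow> (\<exists>n::int. z * of_real pi = of_int n * of_real pi + of_real pi / 2)"
      using False assms by (simp add: free_char_fun cos_eq_0)
    also have "\<dots> \<longleftrightarrow> z \<in> range (free_eigenvalue j)"
    proof
      assume "z \<in> range (free_eigenvalue j)"
      then obtain m where "z = free_eigenvalue j ((m - 1) + 1)" by auto
      then show "\<exists>n::int. z * of_real pi = of_int n * of_real pi + of_real pi / 2"
        unfolding * by blast
    qed (auto simp: *)
    finally show ?thesis .
  qed
  have mult: "eigenvalue_mult j a (\<lambda>_. 0) (\<lambda>_. 0) z = 1" if "?\<Delta> z = 0" for z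
  proof -
    have sc: "sin (z * complex_of_real pi) ^ 2 + cos (z * of_real pi) ^ 2 = 1" by simp
    have "zorder ?\<Delta> z = 1"
    proof (cases "j = 1")
      case True
      then have F: "?\<Delta> = (\<lambda>z. sin (z * of_real pi))" by (auto simp: free_char_fun[unfolded One_nat_def])
      show ?thesis unfolding F
        by (rule zorder_simple[where f' = "\<lambda>z. of_real pi * cos (z * of_real pi)"])
          (use that F sc in \<open>auto intro!: derivative_eq_intros\<close>)
    next
      case False
      then have F: "?\<Delta> = (\<lambda>z. - cos (z * of_real pi))" using assms by (auto simp: free_char_fun)
      show ?thesis unfolding F
        by (rule zorder_simple[where f' = "\<lambda>z. of_real pi * sin (z * of_real pi)"])
          (use that F sc in \<open>auto intro!: derivative_eq_intros\<close>)
    qed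
    then show ?thesis using that by (simp add: eigenvalue_mult_def)
  qed
  have inj: "free_eigenvalue j m = free_eigenvalue j n \<longleftrightarrow> m = n" for m n
    by (simp add: free_eigenvalue_def)
  show ?thesis
    unfolding eigenvalue_sequence_def
  proof
    fix z
    show "finite {n. free_eigenvalue j n = z} \<and>
       card {n. free_eigenvalue j n = z} = eigenvalue_mult j a (\<lambda>_. 0) (\<lambda>_. 0) z"
    proof (cases "?\<Delta> z = 0")
      case True
      then obtain m where "z = free_eigenvalue j m" using zero by auto
      then have "{n. free_eigenvalue j n = z} = {m}" using inj by auto
      then show ?thesis using mult[OF True] by simp
    next
      case False
      then have "{n. free_eigenvalue j n = z} = {}" using zero by auto
      then show ?thesis using False by (simp add: eigenvalue_mult_def)
    qed
  qed
qed

end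

(* In the coordinates w = y1 + i y2, v = y1 - i y2 the equation reads
   w' = i lam w + r v(x - a),  v' = - i lam v + s w(x - a)  with r = q - i p, s = q + i p.
   Each delay costs a factor exp(-|Im lam| a), so both characteristic functions differ from the
   free ones by O(exp((pi - a) |Im lam|)). If this difference vanishes at the zeros of sin(pi lam)
   (or of cos(pi lam)), its quotient by the sine (cosine) is entire, bounded and tends to 0 along the
   imaginary axis, hence is 0 by Liouville. So w(pi) and v(pi) equal their free values for all lam.
   In the resulting integral identity for r the first order term carries the exponents 2 x - a and
   all the others have exponents at most 2 b - 2 a if r vanishes beyond b. Liouville's
   theorem applied to the part of the first order term with 2 x - a > 2 b - 2 a shows that r vanishes
   beyond b - a / 2 already. Starting with b = pi, this exhausts the interval; likewise for s. *)

theory Submission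
  imports Defs
begin

text \<open>The step length \<open>a / 2\<close> is where two bounds meet. With \<open>r\<close>
  vanishing beyond \<open>b\<close>, every contribution with a further delay is at most of size
  \<open>exp (Im lam * (2 * b - a))\<close> times the factor \<open>exp (- Im lam * a)\<close> of
  that delay, in the upper half plane. The first order term obeys the resulting bound
  \<open>exp (Im lam * (2 * b - 2 * a))\<close> exactly for \<open>t\<close> up to
  \<open>b - a / 2\<close>, and only its part beyond that point can be isolated. The gain does not
  depend on \<open>b\<close>, so finitely many steps suffice for every delay. The descents for
  \<open>r\<close> and \<open>s\<close> are independent: the other coefficient enters the remainder
  only through its integral norm, and nothing about its support beyond \<open>(a, pi)\<close> has to
  be known. The analytic obstacle is that coefficients and derivatives are given only almost
  everywhere. Existence of the solution, its absolute continuity and the passage from vanishing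
  integrals back to vanishing coefficients all rest on Lebesgue's differentiation theorem, which is
  therefore proved at the start.\<close>

section \<open>Differentiation of the indefinite integral\<close>

text \<open>A point is bad at scale \<open>e\<close> if arbitrarily short intervals ending there violate the difference
  quotient estimate. Disjoint such intervals, chosen by Vitali's covering lemma, form a fine partial
  division, so Henstock's lemma makes their total length small.\<close>

lemma negligible_nondifferentiable_scale:
  fixes f :: "real \<Rightarrow> 'b::euclidean_space"
  assumes f: "f integrable_on {a..b}" and e: "0 < e"
  shows "negligible {x\<in>{a<..<b}. \<forall>d>0. \<exists>y. 0 < \<bar>y - x\<bar> \<and> \<bar>y - x\<bar> < d \<and>
     e * \<bar>y - x\<bar> \<le> norm (integral {min x y..max x y} f - \<bar>y - x\<bar> *\<^sub>R f x)}" (is "negligible ?S")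
proof -
  define S where "S = ?S"
  have "negligible S"
    unfolding negligible_outer_le
  proof (intro allI impI)
    fix \<epsilon> :: real assume \<epsilon>: "0 < \<epsilon>"
    \<comment> \<open>Vitali's lemma replaces an interval of length \<open>r i\<close> by a ball of
      radius \<open>5 * r i\<close>, hence of length \<open>10 * r i\<close>; the factor
      \<open>e\<close> is the scale in \<open>S\<close>.\<close>
    have "0 < e * \<epsilon> / 10" using e \<epsilon> by simp
    then obtain \<gamma> where \<gamma>: "gauge \<gamma>"
      and H: "\<And>p. \<lbrakk>p tagged_partial_division_of (cbox a b); \<gamma> fine p\<rbrakk> \<Longrightarrow>
               (\<Sum>(x,k)\<in>p. norm (measure lborel k *\<^sub>R f x - integral k f)) < e * \<epsilon> / 10"
      by (rule Henstock_lemma[of f a b, rotated]) (use f in auto)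
    \<comment> \<open>The interval lies on one side of \<open>x\<close>, but the whole ball is kept
      inside the gauge: disjointness will come from the balls. The radius bound 1 is for Vitali's
      lemma.\<close>
    have "\<exists>y. 0 < \<bar>y - x\<bar> \<and> \<bar>y - x\<bar> \<le> 1 \<and> cball x \<bar>y - x\<bar> \<subseteq> \<gamma> x \<inter> {a<..<b} \<and>
       e * \<bar>y - x\<bar> \<le> norm (integral {min x y..max x y} f - \<bar>y - x\<bar> *\<^sub>R f x)" if x: "x \<in> S" for x
    proof -
      have "open (\<gamma> x \<inter> {a<..<b})" "x \<in> \<gamma> x \<inter> {a<..<b}" using \<gamma> x by (auto simp: gauge_def S_def)
      then obtain d where d: "0 < d" "cball x d \<subseteq> \<gamma> x \<inter> {a<..<b}"
        by (meson open_contains_cball)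
      then obtain y where "0 < \<bar>y - x\<bar>" "\<bar>y - x\<bar> < min d 1"
          "e * \<bar>y - x\<bar> \<le> norm (integral {min x y..max x y} f - \<bar>y - x\<bar> *\<^sub>R f x)"
        using x by (auto simp: S_def dest!: spec[of _ "min d 1"])
      moreover then have "cball x \<bar>y - x\<bar> \<subseteq> cball x d" by (intro subset_cball) auto
      ultimately show ?thesis using d(2) by (intro exI[of _ y]) (auto intro: less_imp_le)
    qed
    then have "\<exists>y. \<forall>x\<in>S. 0 < \<bar>y x - x\<bar> \<and> \<bar>y x - x\<bar> \<le> 1 \<and> cball x \<bar>y x - x\<bar> \<subseteq> \<gamma> x \<inter> {a<..<b} \<and>
       e * \<bar>y x - x\<bar> \<le> norm (integral {min x (y x)..max x (y x)} f - \<bar>y x - x\<bar> *\<^sub>R f x)"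
      by (intro bchoice ballI)
    then obtain y where y: "\<And>x. x \<in> S \<Longrightarrow> 0 < \<bar>y x - x\<bar>" "\<And>x. x \<in> S \<Longrightarrow> \<bar>y x - x\<bar> \<le> 1"
        "\<And>x. x \<in> S \<Longrightarrow> cball x \<bar>y x - x\<bar> \<subseteq> \<gamma> x \<inter> {a<..<b}"
        "\<And>x. x \<in> S \<Longrightarrow> e * \<bar>y x - x\<bar> \<le> norm (integral {min x (y x)..max x (y x)} f - \<bar>y x - x\<bar> *\<^sub>R f x)"
      by (auto simp del: abs_le_iff)
    define r where "r x = \<bar>y x - x\<bar>" for x
    define J where "J x = {min x (y x)..max x (y x)}" for x
    have Jc: "J x \<subseteq> cball x (r x)" "x \<in> J x" for x by (auto simp: J_def r_def dist_real_def)
    have cJ: "measure lborel (J x) = r x" for x by (auto simp: J_def r_def)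
    obtain C where C: "countable C" "C \<subseteq> S"
       "pairwise (\<lambda>i j. disjnt (cball i (r i)) (cball j (r j))) C"
       "S \<subseteq> (\<Union>i\<in>C. cball i (5 * r i))"
    proof (rule Vitali_covering_lemma_cballs[where S = S and K = S and a = "\<lambda>x. x" and r = r and B = 1])
      show "S \<subseteq> (\<Union>i\<in>S. cball i (r i))" using y(1) by (force simp: r_def)
    qed (use y in \<open>auto simp: r_def\<close>)
    have meas: "measure lebesgue (\<Union>i\<in>I. cball i (5 * r i)) \<le> \<epsilon>" if I: "I \<subseteq> C" "finite I" for I
    proof -
      define p where "p = (\<lambda>x. (x, J x)) ` I"
      have IS: "x \<in> S" if "x \<in> I" for x using that I C(2) by blast
      have p: "p tagged_partial_division_of (cbox a b)"
        unfolding tagged_partial_division_of_def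
      proof (intro conjI allI impI; (elim conjE)?)
        show "finite p" using I by (simp add: p_def)
        fix x K assume xK: "(x, K) \<in> p"
        then show "x \<in> K" using Jc by (auto simp: p_def)
        have "cball x (r x) \<subseteq> {a<..<b}" using xK y(3)[OF IS] by (auto simp: p_def r_def)
        then show "K \<subseteq> cbox a b" using xK Jc(1)[of x] by (fastforce simp: p_def)
        show "\<exists>a b. K = cbox a b" using xK by (auto simp: p_def J_def)
        fix x2 K2 assume x2: "(x2, K2) \<in> p" "(x, K) \<noteq> (x2, K2)"
        then have "x \<noteq> x2" "x \<in> C" "x2 \<in> C" using xK I by (auto simp: p_def)
        then have "disjnt (cball x (r x)) (cball x2 (r x2))" using C(3) by (auto simp: pairwise_def)
        moreover have "interior K \<subseteq> cball x (r x)" "interior K2 \<subseteq> cball x2 (r x2)"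
          using xK x2 Jc(1) by (auto simp: p_def intro!: order_trans[OF interior_subset] simp del: mem_cball)
        ultimately show "interior K \<inter> interior K2 = {}" by (auto simp: disjnt_def)
      qed
      have "\<gamma> fine p"
        using Jc y(3)[OF IS] by (fastforce simp: fine_def p_def r_def)
      from H[OF p this] have "(\<Sum>x\<in>I. norm (measure lborel (J x) *\<^sub>R f x - integral (J x) f)) < e * \<epsilon> / 10"
        unfolding p_def by (subst (asm) sum.reindex) (auto simp: inj_on_def)
      moreover have "(\<Sum>x\<in>I. e * r x) \<le> (\<Sum>x\<in>I. norm (measure lborel (J x) *\<^sub>R f x - integral (J x) f))"
        using y(4)[OF IS] unfolding cJ unfolding r_def J_def
        by (intro sum_mono) (simp only: norm_minus_commute)
      ultimately have "e * (\<Sum>x\<in>I. r x) < e * (\<epsilon> / 10)" by (simp add: sum_distrib_left)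
      then have s: "(\<Sum>x\<in>I. r x) < \<epsilon> / 10" using e by (simp add: mult_less_cancel_left)
      have "measure lebesgue (\<Union>i\<in>I. cball i (5 * r i)) \<le> (\<Sum>i\<in>I. measure lebesgue (cball i (5 * r i)))"
        using I(2) by (intro measure_UNION_le) auto
      also have "\<dots> = (\<Sum>i\<in>I. 10 * r i)"
        by (intro sum.cong refl) (auto simp: cball_eq_atLeastAtMost r_def)
      also have "\<dots> \<le> \<epsilon>" using s by (simp flip: sum_distrib_left)
      finally show ?thesis .
    qed
    show "\<exists>T. S \<subseteq> T \<and> T \<in> lmeasurable \<and> measure lebesgue T \<le> \<epsilon>"
      using fmeasurable_UN_bound[OF C(1) _ meas] measure_UN_bound[OF C(1) _ meas] C(4)
      by (intro exI[of _ "\<Union>i\<in>C. cball i (5 * r i)"]) auto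
  qed
  then show ?thesis by (simp add: S_def)
qed

text \<open>A point where the derivative fails is bad at some scale, and a bad point stays bad at
  every smaller scale, so the countably many scales \<open>inverse (Suc n)\<close> catch all of
  them.\<close>

lemma negligible_indefinite_integral_nondifferentiable:
  fixes f :: "real \<Rightarrow> 'b::euclidean_space"
  assumes f: "f integrable_on {a..b}"
  shows "negligible {x\<in>{a<..<b}. \<not> ((\<lambda>x. integral {a..x} f) has_vector_derivative f x) (at x)}"
proof -
  define S where "S e = {x\<in>{a<..<b}. \<forall>d>0. \<exists>y. 0 < \<bar>y - x\<bar> \<and> \<bar>y - x\<bar> < d \<and>
     e * \<bar>y - x\<bar> \<le> norm (integral {min x y..max x y} f - \<bar>y - x\<bar> *\<^sub>R f x)}" for e
  have "((\<lambda>x. integral {a..x} f) has_vector_derivative f x) (at x)"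
    if x: "x \<in> {a<..<b}" and nS: "\<And>n. x \<notin> S (inverse (Suc n))" for x
    unfolding has_vector_derivative_def has_derivative_at_alt
  proof (intro conjI allI impI bounded_linear_scaleR_left)
    fix e :: real assume e: "0 < e"
    then obtain n where n: "inverse (real (Suc n)) < e" using reals_Archimedean by blast
    obtain d where d: "0 < d" and D: "\<And>y. 0 < \<bar>y - x\<bar> \<Longrightarrow> \<bar>y - x\<bar> < d \<Longrightarrow>
       norm (integral {min x y..max x y} f - \<bar>y - x\<bar> *\<^sub>R f x) < inverse (Suc n) * \<bar>y - x\<bar>"
      using nS[of n] x by (auto simp: S_def not_le)
    have D': "norm (integral {min x y..max x y} f - \<bar>y - x\<bar> *\<^sub>R f x) \<le> e * \<bar>y - x\<bar>"
      if "0 < \<bar>y - x\<bar>" "\<bar>y - x\<bar> < d" for y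
      using D[OF that] mult_right_mono[OF less_imp_le[OF n] abs_ge_zero, of "y - x"] by linarith
    show "\<exists>d>0. \<forall>y. norm (y - x) < d \<longrightarrow>
       norm (integral {a..y} f - integral {a..x} f - (y - x) *\<^sub>R f x) \<le> e * norm (y - x)"
    proof (intro exI[of _ "min d (min (x - a) (b - x))"] conjI allI impI)
      fix y assume y: "norm (y - x) < min d (min (x - a) (b - x))"
      have *: "integral {a..u} f + integral {u..v} f = integral {a..v} f" if "a \<le> u" "u \<le> v" "v \<le> b" for u v
        using that by (intro Henstock_Kurzweil_Integration.integral_combine integrable_on_subinterval[OF f]) auto
      consider "y = x" | "y < x" | "x < y" by linarith
      then show "norm (integral {a..y} f - integral {a..x} f - (y - x) *\<^sub>R f x) \<le> e * norm (y - x)"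
      proof cases
        case 2
        then have "integral {a..y} f - integral {a..x} f - (y - x) *\<^sub>R f x
            = - (integral {min x y..max x y} f - \<bar>y - x\<bar> *\<^sub>R f x)"
          using *[of y x] x y by (simp add: algebra_simps flip: scaleR_add_left)
        then show ?thesis using D'[of y] 2 y by (simp only: norm_minus_cancel real_norm_def)
      next
        case 3
        then have "integral {a..y} f - integral {a..x} f - (y - x) *\<^sub>R f x
            = (integral {min x y..max x y} f - \<bar>y - x\<bar> *\<^sub>R f x)"
          using *[of x y] x y by (simp add: algebra_simps)
        then show ?thesis using D'[of y] 3 y by (simp only: norm_minus_cancel real_norm_def)
      qed simp
    qed (use d x in auto)
  qed
  then have "{x\<in>{a<..<b}. \<not> ((\<lambda>x. integral {a..x} f) has_vector_derivative f x) (at x)}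
     \<subseteq> (\<Union>n. S (inverse (Suc n)))" by blast
  moreover have "negligible (\<Union>n. S (inverse (Suc n)))"
    unfolding S_def using negligible_nondifferentiable_scale[OF f] by (intro negligible_countable_Union) auto
  ultimately show ?thesis by (rule negligible_subset[rotated])
qed

section \<open>Absolute continuity of the integral and primitives on the line\<close>

lemma set_integral_absolutely_continuous:
  fixes g :: "'a \<Rightarrow> 'b::{banach, second_countable_topology}"
  assumes g: "integrable M g" and e: "0 < e"
  obtains d where "0 < d" "\<And>A. A \<in> fmeasurable M \<Longrightarrow> measure M A < d \<Longrightarrow> (LINT t:A|M. norm (g t)) < e"
proof -
  have gm[measurable]: "g \<in> borel_measurable M" using g by auto
  \<comment> \<open>\<open>T n\<close> is the part of the norm above level \<open>n\<close>: its
    integral tends to 0 by dominated convergence, and the rest contributes at most \<open>n\<close>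
    times the measure of \<open>A\<close>.\<close>
  define T where "T n t = (if real n < norm (g t) then norm (g t) else 0)" for n t
  have [measurable]: "T n \<in> borel_measurable M" for n
    unfolding T_def by measurable
  have Ti: "integrable M (T n)" for n
    by (rule Bochner_Integration.integrable_bound[OF g]) (auto simp: T_def indicator_def)
  have "(\<lambda>n. LINT t|M. T n t) \<longlonglongrightarrow> (LINT t|M. 0)"
  proof (rule integral_dominated_convergence[where w = "\<lambda>t. norm (g t)"])
    show "AE t in M. (\<lambda>n. T n t) \<longlonglongrightarrow> 0"
    proof (rule AE_I2, rule tendsto_eventually)
      fix t
      obtain N where "norm (g t) \<le> real N" using real_arch_simple by blast
      then show "eventually (\<lambda>n. T n t = 0) sequentially"
        by (intro eventually_sequentiallyI[of N]) (auto simp: T_def indicator_def)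
    qed
  qed (use g Ti in \<open>auto simp: T_def indicator_def\<close>)
  then obtain n where n: "(LINT t|M. T n t) < e / 2"
    using order_tendstoD(2)[of _ 0 sequentially "e/2"] e by (force dest!: eventually_happens)
  show ?thesis
  proof
    \<comment> \<open>The summand 1 covers the case that the level \<open>n\<close> is 0.\<close>
    show "0 < e / (2 * (real n + 1))" using e by simp
    fix A assume A: "A \<in> fmeasurable M" "measure M A < e / (2 * (real n + 1))"
    then have As[measurable]: "A \<in> sets M" by auto
    have iA: "integrable M (\<lambda>t. real n * indicator A t)"
      using A by (intro integrable_mult_right integrable_real_indicator) (auto simp: fmeasurable_def)
    have "(LINT t:A|M. norm (g t)) \<le> (LINT t|M. T n t + real n * indicator A t)"
      unfolding set_lebesgue_integral_def
      using g by (intro integral_mono Bochner_Integration.integrable_add Ti iA integrable_mult_indicator integrable_norm)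
        (auto simp: T_def indicator_def)
    also have "\<dots> = (LINT t|M. T n t) + real n * measure M A"
      using A Ti iA by (subst Bochner_Integration.integral_add) auto
    also have "real n * measure M A \<le> (real n + 1) * (e / (2 * (real n + 1)))"
      using A by (intro mult_mono) auto
    also have "\<dots> = e / 2" by (simp add: field_simps)
    finally show "(LINT t:A|M. norm (g t)) < e" using n by simp
  qed
qed

text \<open>Integrating from minus infinity fixes the constant without a base point; for integrands
  supported in \<open>(a, pi)\<close> the result is 0 up to \<open>a\<close>, which later gives the
  initial values.\<close>

definition primitive :: "(real \<Rightarrow> 'a::euclidean_space) \<Rightarrow> real \<Rightarrow> 'a" where
  "primitive g x = (LINT t:{..x}|lebesgue. g t)"

text \<open>A bridge between two integrals: dominated convergence is used for the Lebesgue integral,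
  while differentiation and additivity over divisions are used for the gauge integral on
  intervals.\<close>

lemma primitive_diff:
  fixes g :: "real \<Rightarrow> 'a::euclidean_space"
  assumes g: "integrable lebesgue g" and uv: "u \<le> v"
  shows "primitive g v - primitive g u = integral {u..v} g" "g integrable_on {u..v}"
    "norm (primitive g v - primitive g u) \<le> integral {u..v} (\<lambda>t. norm (g t))"
    "(\<lambda>t. norm (g t)) integrable_on {u..v}"
proof -
  have s: "set_integrable lebesgue A g" if "A \<in> sets lebesgue" for A
    using g that unfolding set_integrable_def by (rule integrable_mult_indicator[rotated])
  have "{..v} = {..u} \<union> {u<..v}" using uv by auto
  then have "primitive g v = primitive g u + (LINT t:{u<..v}|lebesgue. g t)"
    unfolding primitive_def using set_integral_Un[of "{..u}" "{u<..v}" lebesgue g, OF _ s s] ivl_disj_int_one(3)[of u v] by auto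
  also have "(LINT t:{u<..v}|lebesgue. g t) = (LINT t:{u..v}|lebesgue. g t)"
  proof -
    have nu: "AE t in lebesgue. t \<noteq> u"
      by (rule AE_I'[of "{u}"]) (auto simp: negligible_iff_null_sets[symmetric])
    show ?thesis
      unfolding set_lebesgue_integral_def
    proof (rule integral_cong_AE[rotated 2])
      from nu show "AE t in lebesgue. indicator {u<..v} t *\<^sub>R g t = indicator {u..v} t *\<^sub>R g t"
        by (rule eventually_mono) (auto simp: indicator_def)
    qed (rule borel_measurable_integrable[OF s[unfolded set_integrable_def]], simp)+
  qed
  finally show eq: "primitive g v - primitive g u = integral {u..v} g"
    using set_lebesgue_integral_eq_integral(2)[OF s[of "{u..v}"]] by simp
  show gi: "g integrable_on {u..v}" by (rule set_lebesgue_integral_eq_integral(1)[OF s]) simp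
  have "set_integrable lebesgue {u..v} (\<lambda>t. norm (g t))"
    by (intro set_integrable_norm s) simp
  then show *: "(\<lambda>t. norm (g t)) integrable_on {u..v}" by (rule set_lebesgue_integral_eq_integral(1))
  show "norm (primitive g v - primitive g u) \<le> integral {u..v} (\<lambda>t. norm (g t))"
    unfolding eq using gi * by (intro integral_norm_bound_integral) auto
qed

lemma absolutely_continuous_on_primitive:
  fixes g :: "real \<Rightarrow> 'a::euclidean_space"
  assumes g: "integrable lebesgue g"
  shows "absolutely_continuous_on S (primitive g)"
  unfolding absolutely_continuous_on_def
proof (intro allI impI)
  fix e :: real assume e: "0 < e"
  obtain d where d: "0 < d" "\<And>A. A \<in> lmeasurable \<Longrightarrow> measure lebesgue A < d \<Longrightarrow> (LINT t:A|lebesgue. norm (g t)) < e"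
    using set_integral_absolutely_continuous[OF g e] by blast
  show "\<exists>d>0. \<forall>D. D division_of \<Union>D \<and> \<Union>D \<subseteq> S \<and> (\<Sum>k\<in>D. Sup k - Inf k) < d \<longrightarrow>
     (\<Sum>k\<in>D. norm (primitive g (Sup k) - primitive g (Inf k))) < e"
  proof (intro exI[of _ d] conjI allI impI d(1); elim conjE)
    fix D :: "real set set"
    assume D: "D division_of \<Union>D" "(\<Sum>k\<in>D. Sup k - Inf k) < d"
    have "(\<Sum>k\<in>D. Sup k - Inf k) = (\<Sum>k\<in>D. measure lebesgue k)"
      by (rule sum.cong[OF refl], rule division_real_piece[OF D(1)]) auto
    also have "\<dots> = measure lebesgue (\<Union>D)" using content_division[OF D(1)] .
    finally have m: "measure lebesgue (\<Union>D) < d" using D(2) by simp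
    have UD: "\<Union>D \<in> lmeasurable" using D(1) by (metis lmeasurable_division)
    have si: "set_integrable lebesgue (\<Union>D) (\<lambda>t. norm (g t))"
      using g UD unfolding set_integrable_def by (intro integrable_mult_indicator integrable_norm) auto
    have "(\<Sum>k\<in>D. norm (primitive g (Sup k) - primitive g (Inf k))) \<le> (\<Sum>k\<in>D. integral k (\<lambda>t. norm (g t)))"
    proof (rule sum_mono)
      fix k assume "k \<in> D"
      then obtain u v where "k = {u..v}" "u \<le> v" by (rule division_real_piece[OF D(1)])
      then show "norm (primitive g (Sup k) - primitive g (Inf k)) \<le> integral k (\<lambda>t. norm (g t))"
        using primitive_diff[OF g, of u v] by simp
    qed
    also have "\<dots> = integral (\<Union>D) (\<lambda>t. norm (g t))"
      using integral_combine_division_topdown[OF set_lebesgue_integral_eq_integral(1)[OF si] D(1)] by simp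
    also have "\<dots> = (LINT t:\<Union>D|lebesgue. norm (g t))"
      using set_lebesgue_integral_eq_integral(2)[OF si] by simp
    also have "\<dots> < e" using d(2)[OF UD m] .
    finally show "(\<Sum>k\<in>D. norm (primitive g (Sup k) - primitive g (Inf k))) < e" .
  qed
qed

lemma continuous_on_primitive:
  fixes g :: "real \<Rightarrow> 'a::euclidean_space"
  assumes "integrable lebesgue g"
  shows "continuous_on S (primitive g)"
proof -
  have "isCont (primitive g) x" for x
  proof (rule continuous_on_interior[of "{x - 1..x + 1}"])
    show "continuous_on {x - 1..x + 1} (primitive g)"
      using absolutely_continuous_on_primitive[OF assms] by (rule absolutely_continuous_on_imp_continuous_on)
  qed auto
  then show ?thesis by (simp add: continuous_at_imp_continuous_on)
qed

text \<open>On \<open>(-n, n)\<close> the primitive differs from the integral starting at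
  \<open>-n\<close> by a constant, so the exceptional sets of these integrals can be collected over
  \<open>n\<close>.\<close>

lemma primitive_has_vector_derivative_AE:
  fixes g :: "real \<Rightarrow> 'a::euclidean_space"
  assumes g: "integrable lebesgue g"
  shows "AE x in lebesgue. (primitive g has_vector_derivative g x) (at x)"
proof -
  define N where "N n = {x\<in>{-real n<..<real n}. \<not> ((\<lambda>x. integral {-real n..x} g) has_vector_derivative g x) (at x)}" for n
  have "negligible (N n)" for n
    unfolding N_def
    by (rule negligible_indefinite_integral_nondifferentiable, rule primitive_diff(2)[OF g]) simp
  then have neg: "negligible (\<Union>n. N n)" by (intro negligible_countable_Union) auto
  show ?thesis
  proof (rule AE_I')
    show "(\<Union>n. N n) \<in> null_sets lebesgue" using neg by (simp add: negligible_iff_null_sets)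
    have "(primitive g has_vector_derivative g x) (at x)" if nx: "\<forall>n. x \<notin> N n" for x
    proof -
      obtain n :: nat where n: "\<bar>x\<bar> < real n" using reals_Archimedean2 by blast
      then have "((\<lambda>x. integral {-real n..x} g) has_vector_derivative g x) (at x)"
        using nx by (auto simp: N_def)
      then have "((\<lambda>x. primitive g (- real n) + integral {-real n..x} g) has_vector_derivative g x) (at x)"
        by (auto intro!: derivative_eq_intros)
      then show ?thesis
        by (rule has_vector_derivative_transform_within_open[of _ _ _ "{- real n<..<real n}"])
          (use n primitive_diff(1)[OF g, of "- real n"] in \<open>auto simp flip: primitive_diff(1)[OF g]\<close>)
    qed
    then show "{x \<in> space lebesgue. \<not> (primitive g has_vector_derivative g x) (at x)} \<subseteq> (\<Union>n. N n)" by auto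
  qed
qed

lemma primitive_eq_zero_imp_AE:
  fixes g :: "real \<Rightarrow> 'a::euclidean_space"
  assumes g: "integrable lebesgue g" and z: "\<And>x. primitive g x = 0"
  shows "AE x in lebesgue. g x = 0"
  using primitive_has_vector_derivative_AE[OF g]
proof (rule eventually_mono)
  fix x assume "(primitive g has_vector_derivative g x) (at x)"
  moreover have "primitive g = (\<lambda>_. 0)" using z by auto
  ultimately show "g x = 0" using vector_derivative_unique_at has_vector_derivative_const by metis
qed

section \<open>Entire functions defined by integrals\<close>

text \<open>Domination of the functions alone is enough: Cauchy's inequality on unit circles turns
  it into domination of the derivatives, hence of the difference quotients, and dominated
  convergence applies along every sequence tending to \<open>z\<close>.\<close>

lemma integral_has_field_derivative_entire:
  fixes F :: "complex \<Rightarrow> 'a \<Rightarrow> complex"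
  assumes hol: "\<And>t. (\<lambda>z. F z t) holomorphic_on UNIV"
    and meas: "\<And>z. F z \<in> borel_measurable M"
    and dom: "\<And>R. \<exists>g. integrable M g \<and> (\<forall>z t. norm z \<le> R \<longrightarrow> norm (F z t) \<le> g t)"
  shows "((\<lambda>z. LINT t|M. F z t) has_field_derivative (LINT t|M. deriv (\<lambda>z. F z t) z)) (at z)"
  unfolding has_field_derivative_iff tendsto_at_iff_sequentially
proof (intro allI impI)
  fix X assume X: "\<forall>i. X i \<in> UNIV - {z}" "X \<longlonglongrightarrow> z"
  \<comment> \<open>Radius \<open>norm z + 2\<close>: one unit for the points of
    \<open>cball z 1\<close>, another for the unit circles around them in Cauchy's
    inequality.\<close>
  obtain g where g: "integrable M g" "\<And>w t. norm w \<le> norm z + 2 \<Longrightarrow> norm (F w t) \<le> g t"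
    using dom[of "norm z + 2"] by blast
  have Fi: "integrable M (F w)" for w
  proof -
    obtain g where "integrable M g" "\<And>u t. norm u \<le> norm w \<Longrightarrow> norm (F u t) \<le> g t"
      using dom[of "norm w"] by blast
    moreover from this(2) have "norm (F w t) \<le> norm (g t)" for t
      by (rule order_trans) auto
    ultimately show ?thesis
      by (intro Bochner_Integration.integrable_bound[OF _ meas] AE_I2)
  qed
  have der: "((\<lambda>z. F z t) has_field_derivative deriv (\<lambda>z. F z t) w) (at w)" for w t
    using hol by (rule holomorphic_derivI) auto
  have quot: "norm ((F w t - F z t) / (w - z)) \<le> g t" if w: "dist w z \<le> 1" "w \<noteq> z" for w t
  proof -
    have "norm (F w t - F z t) \<le> g t * norm (w - z)"
    proof (rule field_differentiable_bound[of "cball z 1" "\<lambda>z. F z t" "deriv (\<lambda>z. F z t)"])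
      fix u assume u: "u \<in> cball z 1"
      have "norm ((deriv ^^ 1) (\<lambda>z. F z t) u) \<le> fact 1 * g t / 1 ^ 1"
      proof (rule Cauchy_inequality)
        show "norm (F x t) \<le> g t" if "norm (u - x) = 1" for x
        proof (rule g)
          have "norm x \<le> norm (u - x) + norm (z - u) + norm z"
            using norm_triangle_ineq4[of u "u - x"] norm_triangle_ineq4[of z "z - u"] by simp
          then show "norm x \<le> norm z + 2" using u that by (simp add: dist_norm)
        qed
      qed (auto intro: holomorphic_on_subset[OF hol] holomorphic_on_imp_continuous_on)
      then show "norm (deriv (\<lambda>z. F z t) u) \<le> g t" by simp
    qed (use w in \<open>auto simp: dist_commute intro: has_field_derivative_at_within[OF der]\<close>)
    then show ?thesis using w by (simp add: norm_divide divide_le_eq)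
  qed
  obtain N where N: "\<And>n. n \<ge> N \<Longrightarrow> dist (X n) z \<le> 1"
    using X(2) by (meson lim_sequentially less_imp_le zero_less_one)
  let ?D = "\<lambda>t. deriv (\<lambda>z. F z t) z"
  let ?s = "\<lambda>n t. (F (X (n + N)) t - F z t) / (X (n + N) - z)"
  have XN: "(\<lambda>n. X (n + N)) \<longlonglongrightarrow> z" using X(2) by (rule LIMSEQ_ignore_initial_segment)
  have fl: "filterlim (\<lambda>n. X (n + N)) (at z) sequentially"
    using XN X(1) by (auto simp: filterlim_at)
  have lim: "(\<lambda>n. ?s n t) \<longlonglongrightarrow> ?D t" for t
    by (rule filterlim_compose[OF der[of t z, unfolded has_field_derivative_iff] fl])
  have sm: "?s n \<in> borel_measurable M" for n
    using meas by (intro borel_measurable_divide borel_measurable_diff) auto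
  have "(\<lambda>n. LINT t|M. ?s n t) \<longlonglongrightarrow> (LINT t|M. ?D t)"
  proof (rule integral_dominated_convergence[where w = g])
    show "?D \<in> borel_measurable M" using sm lim by (rule borel_measurable_LIMSEQ_metric)
  qed (use g sm lim quot N X(1) in auto)
  moreover have "(LINT t|M. ?s n t) = ((LINT t|M. F (X (n + N)) t) - (LINT t|M. F z t)) / (X (n + N) - z)" for n
    by (simp only: integral_divide_zero Bochner_Integration.integral_diff[OF Fi Fi])
  ultimately have "(\<lambda>n. ((LINT t|M. F (X (n + N)) t) - (LINT t|M. F z t)) / (X (n + N) - z)) \<longlonglongrightarrow> (LINT t|M. ?D t)"
    by (simp only:)
  then show "((\<lambda>y. ((LINT t|M. F y t) - (LINT t|M. F z t)) / (y - z)) \<circ> X) \<longlonglongrightarrow> (LINT t|M. ?D t)"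
    unfolding comp_def by (rule LIMSEQ_offset)
qed

lemma integral_holomorphic_on_UNIV:
  fixes F :: "complex \<Rightarrow> 'a \<Rightarrow> complex"
  assumes "\<And>t. (\<lambda>z. F z t) holomorphic_on UNIV"
    and "\<And>z. F z \<in> borel_measurable M"
    and "\<And>R. \<exists>g. integrable M g \<and> (\<forall>z t. norm z \<le> R \<longrightarrow> norm (F z t) \<le> g t)"
  shows "(\<lambda>z. LINT t|M. F z t) holomorphic_on UNIV"
  unfolding holomorphic_on_def field_differentiable_def
  by (intro ballI exI, rule has_field_derivative_at_within, rule integral_has_field_derivative_entire)
    (rule assms)+

section \<open>Uniqueness of moments and Fourier transforms on bounded support\<close>

lemma integrable_times_bounded_on_support:
  fixes f :: "real \<Rightarrow> complex"
  assumes f: "integrable lebesgue f" "\<And>x. x \<notin> S \<Longrightarrow> f x = 0"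
    and h: "h \<in> borel_measurable borel" "\<And>x. x \<in> S \<Longrightarrow> norm (h x) \<le> K"
  shows "integrable lebesgue (\<lambda>x. f x * h x)"
proof (rule Bochner_Integration.integrable_bound[of _ "\<lambda>x. K * norm (f x)"])
  show "AE x in lebesgue. norm (f x * h x) \<le> norm (K * norm (f x))"
  proof (rule AE_I2)
    fix x
    show "norm (f x * h x) \<le> norm (K * norm (f x))"
    proof (cases "x \<in> S")
      case True
      then have "norm (h x) * norm (f x) \<le> K * norm (f x)" using h(2) by (intro mult_right_mono) auto
      then show ?thesis by (simp add: norm_mult mult.commute)
    qed (use f(2) in simp)
  qed
  show "(\<lambda>x. f x * h x) \<in> borel_measurable lebesgue"
    using h(1) by (intro borel_measurable_times borel_measurable_integrable[OF f(1)] measurable_completion) simp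
qed (use f in auto)

text \<open>By Weierstrass approximation \<open>f\<close> annihilates all continuous functions, and
  by a limit of continuous ramps also the indicators of half lines. So its primitive is 0, and
  almost everywhere differentiation recovers \<open>f\<close>.\<close>

lemma moments_zero_imp_AE_zero:
  fixes f :: "real \<Rightarrow> complex"
  assumes f: "integrable lebesgue f" "\<And>x. x \<notin> {u..v} \<Longrightarrow> f x = 0"
    and mom: "\<And>n::nat. (LINT x|lebesgue. f x * of_real x ^ n) = 0"
  shows "AE x in lebesgue. f x = 0"
proof (rule primitive_eq_zero_imp_AE[OF f(1)])
  have fi: "integrable lebesgue (\<lambda>x. f x * h x)" if "continuous_on UNIV h" for h
  proof -
    have "bounded (h ` {u..v})"
      using that by (intro compact_imp_bounded compact_continuous_image) (auto intro: continuous_on_subset)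
    then obtain K where "\<And>x. x \<in> {u..v} \<Longrightarrow> norm (h x) \<le> K" unfolding bounded_iff by blast
    then show ?thesis
      using f that by (intro integrable_times_bounded_on_support[where S = "{u..v}"])
        (auto intro: borel_measurable_continuous_onI)
  qed
  have cont: "(LINT x|lebesgue. f x * of_real (\<phi> x)) = 0" if \<phi>: "continuous_on UNIV (\<phi> :: real \<Rightarrow> real)" for \<phi>
  proof -
    have "norm (LINT x|lebesgue. f x * of_real (\<phi> x)) \<le> e * (LINT x|lebesgue. norm (f x))" if e: "0 < e" for e
    proof -
      obtain g where g: "real_polynomial_function g" "\<And>x. x \<in> {u..v} \<Longrightarrow> \<bar>\<phi> x - g x\<bar> < e"
        using Stone_Weierstrass_real_polynomial_function[of "{u..v}" \<phi> e] \<phi> e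
        by (metis compact_Icc continuous_on_subset subset_UNIV)
      obtain c n where gs: "g = (\<lambda>x. \<Sum>i\<le>n. c i * x ^ i)"
        using g(1) by (auto simp: real_polynomial_function_iff_sum)
      have gc: "continuous_on UNIV g" unfolding gs by (intro continuous_intros)
      have "(LINT x|lebesgue. f x * of_real (g x)) = (LINT x|lebesgue. (\<Sum>i\<le>n. of_real (c i) * (f x * of_real x ^ i)))"
        by (intro Bochner_Integration.integral_cong refl) (simp add: gs sum_distrib_left mult_ac)
      also have "\<dots> = (\<Sum>i\<le>n. LINT x|lebesgue. of_real (c i) * (f x * of_real x ^ i))"
        by (intro Bochner_Integration.integral_sum integrable_mult_right fi continuous_intros)
      also have "\<dots> = 0" by (simp add: mom)
      finally have "(LINT x|lebesgue. f x * of_real (\<phi> x))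
          = (LINT x|lebesgue. f x * of_real (\<phi> x)) - (LINT x|lebesgue. f x * of_real (g x))" by simp
      also have "\<dots> = (LINT x|lebesgue. f x * of_real (\<phi> x) - f x * of_real (g x))"
        using \<phi> gc by (intro Bochner_Integration.integral_diff[symmetric] fi continuous_intros) auto
      also have "norm \<dots> \<le> (LINT x|lebesgue. e * norm (f x))"
      proof (rule Bochner_Integration.integral_norm_bound_integral)
        fix x
        show "norm (f x * of_real (\<phi> x) - f x * of_real (g x)) \<le> e * norm (f x)"
        proof (cases "x \<in> {u..v}")
          case True
          have "norm (f x * of_real (\<phi> x) - f x * of_real (g x)) = \<bar>\<phi> x - g x\<bar> * norm (f x)"
            by (simp add: norm_mult mult.commute flip: right_diff_distrib of_real_diff)
          also have "\<dots> \<le> e * norm (f x)" using g(2)[OF True] by (intro mult_right_mono) auto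
          finally show ?thesis .
        qed (use f(2) in simp)
      qed (use f \<phi> gc in \<open>auto intro!: Bochner_Integration.integrable_diff fi continuous_intros\<close>)
      finally show ?thesis by simp
    qed
    then have *: "norm (LINT x|lebesgue. f x * of_real (\<phi> x)) \<le> e * (LINT x|lebesgue. norm (f x))" if "0 < e" for e
      using that by blast
    have I: "0 \<le> (LINT x|lebesgue. norm (f x))" by simp
    have "norm (LINT x|lebesgue. f x * of_real (\<phi> x)) \<le> 0"
    proof (rule field_le_epsilon)
      fix e :: real assume e: "0 < e"
      \<comment> \<open>The summand 1 keeps the denominator positive when \<open>f\<close> has norm
        0.\<close>
      have le: "e / (1 + c) * c \<le> e" if "0 \<le> c" for c using that e by (simp add: field_simps)
      have "0 < e / (1 + (LINT x|lebesgue. norm (f x)))" using e I by (intro divide_pos_pos) linarith+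
      then have "norm (LINT x|lebesgue. f x * of_real (\<phi> x)) \<le> e / (1 + (LINT x|lebesgue. norm (f x))) * (LINT x|lebesgue. norm (f x))"
        by (rule *)
      also have "\<dots> \<le> e" by (rule le[OF I])
      finally show "norm (LINT x|lebesgue. f x * of_real (\<phi> x)) \<le> 0 + e" by simp
    qed
    then show ?thesis by simp
  qed
  fix x0
  \<comment> \<open>For positive \<open>n\<close> a ramp: 1 up to \<open>x0\<close>, then linear
    down to 0 at \<open>x0 + 1 / n\<close>.\<close>
  define \<phi> where "\<phi> n t = max 0 (min 1 (1 - real n * (t - x0)))" for n t
  have \<phi>c: "continuous_on UNIV (\<phi> n)" for n unfolding \<phi>_def by (intro continuous_intros)
  have \<phi>1: "\<bar>\<phi> n t\<bar> \<le> 1" for n t by (auto simp: \<phi>_def)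
  have \<phi>lim: "(\<lambda>n. \<phi> n t) \<longlonglongrightarrow> indicat_real {..x0} t" for t
  proof (cases "t \<le> x0")
    case True
    then have "\<phi> n t = 1" for n by (auto simp: \<phi>_def mult_nonneg_nonpos)
    then show ?thesis using True by simp
  next
    case False
    obtain N where N: "1 / (t - x0) \<le> real N" using real_arch_simple by blast
    have "eventually (\<lambda>n. \<phi> n t = 0) sequentially"
    proof (rule eventually_sequentiallyI)
      fix n assume "N \<le> n"
      then have "1 / (t - x0) \<le> real n" using N by linarith
      then show "\<phi> n t = 0" using False by (simp add: \<phi>_def field_simps)
    qed
    then show ?thesis using False by (simp add: tendsto_eventually)
  qed
  have "(\<lambda>n. LINT t|lebesgue. f t * of_real (\<phi> n t)) \<longlonglongrightarrow> (LINT t|lebesgue. indicat_real {..x0} t *\<^sub>R f t)"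
  proof (rule integral_dominated_convergence[where w = "\<lambda>t. norm (f t)"])
    show "(\<lambda>t. indicat_real {..x0} t *\<^sub>R f t) \<in> borel_measurable lebesgue"
      using f by (intro borel_measurable_integrable integrable_mult_indicator) auto
    show "AE t in lebesgue. (\<lambda>n. f t * of_real (\<phi> n t)) \<longlonglongrightarrow> indicat_real {..x0} t *\<^sub>R f t"
      unfolding scaleR_conv_of_real
      by (subst mult.commute) (intro AE_I2 tendsto_intros \<phi>lim)
    show "AE t in lebesgue. norm (f t * of_real (\<phi> n t)) \<le> norm (f t)" for n
      using \<phi>1 by (intro AE_I2) (simp add: norm_mult mult_left_le)
    show "(\<lambda>t. f t * of_real (\<phi> n t)) \<in> borel_measurable lebesgue" for n
      using \<phi>c by (intro borel_measurable_integrable fi continuous_intros) auto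
  qed (use f in auto)
  then have "(\<lambda>n. 0) \<longlonglongrightarrow> primitive f x0"
    using cont[OF \<phi>c] by (simp add: primitive_def set_lebesgue_integral_def)
  then show "primitive f x0 = 0" by (simp add: LIMSEQ_const_iff)
qed

text \<open>The moments are, up to powers of \<open>\<i>\<close>, the derivatives of the transform
  at 0. Bounded support makes the transform entire and permits differentiation under the
  integral.\<close>

lemma fourier_zero_imp_AE_zero:
  fixes f :: "real \<Rightarrow> complex"
  assumes f: "integrable lebesgue f" "\<And>x. x \<notin> {u..v} \<Longrightarrow> f x = 0"
    and four: "\<And>lam. (LINT x|lebesgue. f x * exp (\<i> * lam * of_real x)) = 0"
  shows "AE x in lebesgue. f x = 0"
proof (rule moments_zero_imp_AE_zero[OF f])
  fix n :: nat
  define w where "w = max \<bar>u\<bar> \<bar>v\<bar>"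
  have "(LINT x|lebesgue. f x * (\<i> * of_real x) ^ n * exp (\<i> * lam * of_real x)) = 0" for lam
  proof (induction n arbitrary: lam)
    case (Suc n)
    let ?F = "\<lambda>lam x. f x * (\<i> * of_real x) ^ n * exp (\<i> * lam * of_real x)"
    have "((\<lambda>lam. LINT x|lebesgue. ?F lam x) has_field_derivative
        (LINT x|lebesgue. deriv (\<lambda>lam. ?F lam x) lam)) (at lam)" for lam
    proof (rule integral_has_field_derivative_entire)
      show "(\<lambda>lam. ?F lam x) holomorphic_on UNIV" for x by (intro holomorphic_intros)
      show "?F lam \<in> borel_measurable lebesgue" for lam
        unfolding mult.assoc
      proof (intro borel_measurable_times)
        show "f \<in> borel_measurable lebesgue" using f by auto
      qed (auto intro!: measurable_completion borel_measurable_continuous_onI continuous_intros)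
      fix R
      show "\<exists>g. integrable lebesgue g \<and> (\<forall>lam x. norm lam \<le> R \<longrightarrow> norm (?F lam x) \<le> g x)"
      proof (intro exI conjI allI impI)
        show "integrable lebesgue (\<lambda>x. norm (f x) * (w ^ n * exp (R * w)))"
          using f by (intro integrable_mult_left integrable_norm)
        fix lam x assume lam: "norm (lam :: complex) \<le> R"
        show "norm (?F lam x) \<le> norm (f x) * (w ^ n * exp (R * w))"
        proof (cases "x \<in> {u..v}")
          case True
          then have xw: "\<bar>x\<bar> \<le> w" by (auto simp: w_def)
          have "norm (exp (\<i> * lam * of_real x)) \<le> exp (norm (\<i> * lam * of_real x))" by (rule norm_exp)
          also have "\<dots> \<le> exp (R * w)"
            using lam xw order_trans[OF norm_ge_zero lam] by (auto simp: norm_mult intro!: mult_mono)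
          finally have "norm (\<i> * of_real x) ^ n * norm (exp (\<i> * lam * of_real x)) \<le> w ^ n * exp (R * w)"
            using xw by (intro mult_mono power_mono) (auto simp: norm_mult)
          then show ?thesis
            by (auto simp: norm_mult norm_power mult.assoc intro!: mult_left_mono)
        qed (use f in simp)
      qed
    qed
    from this[unfolded Suc.IH] have "(LINT x|lebesgue. deriv (\<lambda>lam. ?F lam x) lam) = 0"
      by (rule DERIV_unique[OF _ DERIV_const])
    moreover have "deriv (\<lambda>lam. ?F lam x) lam = f x * (\<i> * of_real x) ^ Suc n * exp (\<i> * lam * of_real x)" for x
      by (rule DERIV_imp_deriv) (auto intro!: derivative_eq_intros)
    ultimately show ?case by simp
  qed (use four in simp)
  from this[of 0] have "(LINT x|lebesgue. \<i> ^ n * (f x * of_real x ^ n)) = 0"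
    by (simp add: power_mult_distrib mult_ac)
  then show "(LINT x|lebesgue. f x * of_real x ^ n) = 0" by simp
qed

section \<open>Entire functions vanishing at the integers\<close>

text \<open>The squared norm of the sine is
  \<open>(exp y + exp (- y) - 2 * cos (2 * pi * Re z)) / 4\<close> with
  \<open>y = 2 * pi * \<bar>Im z\<bar>\<close>. Under either assumption the cosine term costs at
  most three quarters of \<open>exp y\<close>: for \<open>\<bar>Im z\<bar> \<ge> 1\<close> because
  \<open>exp y \<ge> 5\<close>, on the vertical lines because it has the favourable sign.\<close>

lemma norm_sin_pi_ge:
  fixes z :: complex
  assumes "1 \<le> \<bar>Im z\<bar> \<or> cos (2 * pi * Re z) = -1"
  shows "exp (pi * \<bar>Im z\<bar>) / 4 \<le> norm (sin (of_real pi * z))"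
proof (rule power2_le_imp_le)
  define y where "y = 2 * (pi * \<bar>Im z\<bar>)"
  have sq: "(exp (pi * \<bar>Im z\<bar>) / 4)\<^sup>2 = exp y / 16"
    by (simp add: y_def power_divide power2_eq_square flip: exp_add)
  have "exp y \<le> exp (2 * (pi * Im z)) + inverse (exp (2 * (pi * Im z)))"
    by (cases "0 \<le> Im z") (auto simp: y_def simp flip: exp_minus)
  moreover have "exp y / 4 \<le> exp y - 2 * cos (2 * pi * Re z)"
    using assms
  proof
    assume "1 \<le> \<bar>Im z\<bar>"
    then have "2 * 1 \<le> pi * \<bar>Im z\<bar>" using pi_ge_two by (intro mult_mono) auto
    then have "4 \<le> y" by (simp add: y_def)
    then have "5 \<le> exp y" using exp_ge_add_one_self[of y] by linarith
    then show ?thesis using cos_le_one[of "2 * pi * Re z"] by linarith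
  next
    assume "cos (2 * pi * Re z) = -1"
    then show ?thesis using exp_gt_zero[of y] by linarith
  qed
  ultimately show "(exp (pi * \<bar>Im z\<bar>) / 4)\<^sup>2 \<le> (norm (sin (of_real pi * z)))\<^sup>2"
    unfolding sq norm_sin_squared by (simp add: mult.assoc)
qed simp

text \<open>The zeros of the sine at the integers are simple. Near such a zero the quotient equals
  the quotient of two difference quotients, both with removable singularities, the lower one with
  nonzero limit.\<close>

lemma entire_quotient_sin_pi:
  assumes d: "d holomorphic_on UNIV" and z: "\<And>n::int. d (of_int n) = 0"
  obtains h where "h holomorphic_on UNIV" "\<And>z. d z = h z * sin (of_real pi * z)"
proof
  define h where "h z = (if z \<in> \<int> then deriv d z / (of_real pi * cos (of_real pi * z)) else d z / sin (of_real pi * z))" for z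
  let ?s = "\<lambda>z. sin (complex_of_real pi * z)"
  have s0: "?s z = 0 \<longleftrightarrow> z \<in> \<int>" for z
    by (auto simp: sin_eq_0 mult.commute[of "of_real pi"] Ints_def)
  have sh: "?s holomorphic_on UNIV" by (intro holomorphic_intros)
  have ds: "deriv ?s z = of_real pi * cos (of_real pi * z)" for z
    by (rule DERIV_imp_deriv) (auto intro!: derivative_eq_intros)
  show "d z = h z * ?s z" for z
    using s0[of z] z by (auto simp: h_def elim!: Ints_cases)
  have transform: "h field_differentiable (at z)"
    if "f field_differentiable (at z)" "open S" "z \<in> S" "\<And>w. w \<in> S \<Longrightarrow> f w = h w" for f S z
    using that unfolding field_differentiable_def by (metis has_field_derivative_transform_within_open)
  have "h field_differentiable (at z)" for z
  proof (cases "z \<in> \<int>")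
    case False
    show ?thesis
    proof (rule transform)
      show "(\<lambda>z. d z / ?s z) field_differentiable (at z)"
        using d sh False s0 by (intro field_differentiable_divide) (auto simp: holomorphic_on_def)
      show "open (- \<int> :: complex set)" by (simp add: open_Compl)
    qed (use False in \<open>auto simp: h_def\<close>)
  next
    case True
    then obtain n where n: "z = of_int n" by (rule Ints_cases)
    let ?q = "\<lambda>f w. if w = z then deriv f z else (f w - f z) / (w - z)"
    have q: "?q f field_differentiable (at z)" if "f holomorphic_on UNIV" for f
      using pole_lemma_open[OF that open_UNIV, of z] by (auto simp: holomorphic_on_def)
    show ?thesis
    proof (rule transform)
      have "cos (of_real pi * z) \<noteq> 0"
        using True s0 sin_cos_squared_add[of "of_real pi * z"] by force
      then show "(\<lambda>w. ?q d w / ?q ?s w) field_differentiable (at z)"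
        by (intro field_differentiable_divide q d sh) (simp add: ds)
      \<comment> \<open>The unit ball contains no integer other than \<open>z\<close>, so off the
        centre \<open>h\<close> is given by the plain quotient.\<close>
      fix w assume w: "w \<in> ball z 1"
      show "?q d w / ?q ?s w = h w"
      proof (cases "w = z")
        case False
        have "w \<notin> \<int>"
        proof
          assume "w \<in> \<int>"
          then obtain m where "w = of_int m" by (rule Ints_cases)
          then have "\<bar>real_of_int (n - m)\<bar> < 1" 
            using w n by (simp add: dist_norm flip: of_int_diff)
          then show False using False \<open>w = of_int m\<close> n by simp
        qed
        moreover have "d z = 0" "?s z = 0" using n z s0 True by auto
        ultimately show ?thesis using False by (simp add: h_def)
      qed (use True in \<open>simp add: h_def ds\<close>)
    qed auto
  qed
  then show "h holomorphic_on UNIV" by (auto simp: holomorphic_on_def)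
qed

text \<open>The sine is large off the strip \<open>\<bar>Im z\<bar> < 1\<close> and on the lines \<open>Re z \<in> \<int> + 1/2\<close>; inside the remaining
  rectangles the quotient is bounded by the maximum principle.\<close>

lemma entire_zero_on_integers_imp_zero:
  assumes d: "d holomorphic_on UNIV" and z: "\<And>n::int. d (of_int n) = 0" and k: "0 < k"
    and bound: "\<And>z. norm (d z) \<le> C * exp ((pi - k) * \<bar>Im z\<bar>)"
  shows "d z = 0"
proof -
  obtain h where h: "h holomorphic_on UNIV" "\<And>z. d z = h z * sin (of_real pi * z)"
    using entire_quotient_sin_pi[OF d z] by blast
  have C: "0 \<le> C" using order_trans[OF norm_ge_zero bound[of 0]] by simp
  have hb: "norm (h w) \<le> 4 * C * exp (- k * \<bar>Im w\<bar>)" if w: "1 \<le> \<bar>Im w\<bar> \<or> cos (2 * pi * Re w) = -1" for w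
  proof -
    have "norm (h w) * (exp (pi * \<bar>Im w\<bar>) / 4) \<le> norm (h w) * norm (sin (of_real pi * w))"
      by (intro mult_left_mono norm_sin_pi_ge w) auto
    also have "\<dots> \<le> C * exp ((pi - k) * \<bar>Im w\<bar>)" using bound[of w] by (simp add: h(2) norm_mult)
    also have "\<dots> = 4 * C * exp (- k * \<bar>Im w\<bar>) * (exp (pi * \<bar>Im w\<bar>) / 4)"
      by (simp add: algebra_simps flip: exp_add)
    finally show ?thesis by (rule mult_right_le_imp_le) simp
  qed
  have hb': "norm (h w) \<le> 4 * C" if "1 \<le> \<bar>Im w\<bar> \<or> cos (2 * pi * Re w) = -1" for w
  proof -
    have "4 * C * exp (- k * \<bar>Im w\<bar>) \<le> 4 * C * 1" using C k by (intro mult_left_mono) auto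
    then show ?thesis using hb[OF that] by simp
  qed
  have "norm (h w) \<le> 4 * C" for w
  proof (cases "1 \<le> \<bar>Im w\<bar>")
    case False
    \<comment> \<open>The integer nearest to \<open>Re w\<close>: the rectangle is centred at
      \<open>n\<close>, so its vertical sides lie on lines where the sine is large.\<close>
    define n where "n = \<lfloor>Re w + 1/2\<rfloor>"
    have n: "real_of_int n \<le> Re w + 1/2" "Re w + 1/2 \<le> real_of_int n + 1"
      unfolding n_def by linarith+
    let ?S = "cbox (Complex (of_int n - 1/2) (-1)) (Complex (of_int n + 1/2) 1)"
    show ?thesis
    proof (rule maximum_modulus_frontier[of h ?S])
      fix u assume "u \<in> frontier ?S"
      then consider "Re u = of_int n - 1/2" | "Re u = of_int n + 1/2" | "1 \<le> \<bar>Im u\<bar>"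
        by (auto simp: frontier_cbox in_cbox_complex_iff in_box_complex_iff)
      then show "norm (h u) \<le> 4 * C"
      proof cases
        case 1
        have "cos (2 * pi * Re u) = cos (2 * pi * of_int n - pi)" unfolding 1 by (simp add: algebra_simps)
        also have "\<dots> = -1" by (simp only: cos_diff cos_int_2pin sin_int_2pin) simp
        finally show ?thesis by (intro hb' disjI2)
      next
        case 2
        have "cos (2 * pi * Re u) = cos (2 * pi * of_int n + pi)" unfolding 2 by (simp add: algebra_simps)
        also have "\<dots> = -1" by (simp only: cos_add cos_int_2pin sin_int_2pin) simp
        finally show ?thesis by (intro hb' disjI2)
      qed (use hb' in blast)
    qed (use n False h(1) in \<open>auto simp: in_cbox_complex_iff intro: holomorphic_on_subset holomorphic_on_imp_continuous_on\<close>)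
  qed (use hb' in blast)
  then have "h constant_on UNIV"
    by (intro Liouville_theorem h(1) boundedI[where B = "4 * C"]) auto
  then obtain c where c: "\<And>w. h w = c" by (auto simp: constant_on_def)
  have "norm c \<le> 0"
  proof (rule tendsto_lowerbound)
    have "filterlim (\<lambda>n. - (k * real n)) at_bot sequentially"
      unfolding filterlim_uminus_at_bot minus_minus
      by (rule filterlim_tendsto_pos_mult_at_top[OF tendsto_const k filterlim_real_sequentially])
    then have "(\<lambda>n. exp (- (k * real n))) \<longlonglongrightarrow> 0"
      by (rule filterlim_compose[OF exp_at_bot])
    then show "(\<lambda>n. 4 * C * exp (- (k * real n))) \<longlonglongrightarrow> 0"
      by (rule tendsto_mult_right_zero)
    show "eventually (\<lambda>n. norm c \<le> 4 * C * exp (- (k * real n))) sequentially"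
    proof (rule eventually_sequentiallyI)
      fix n :: nat assume "1 \<le> n"
      then show "norm c \<le> 4 * C * exp (- (k * real n))"
        using hb[of "Complex 0 (real n)"] c by simp
    qed
  qed simp
  then show ?thesis using h(2) c by simp
qed

section \<open>Successive approximations\<close>

lemma primitive_cong:
  assumes "\<And>t. t \<le> x \<Longrightarrow> f t = g t"
  shows "primitive f x = primitive g x"
  unfolding primitive_def set_lebesgue_integral_def
  by (rule Bochner_Integration.integral_cong) (use assms in \<open>auto simp: indicator_def\<close>)

lemma norm_primitive_le:
  fixes k :: "real \<Rightarrow> 'a::euclidean_space" and r :: "real \<Rightarrow> 'b::euclidean_space"
  assumes k: "integrable lebesgue k" and r: "integrable lebesgue r"
    and le: "\<And>t. t \<le> x \<Longrightarrow> norm (k t) \<le> norm (r t) * c" and c: "0 \<le> c"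
  shows "norm (primitive k x) \<le> (LINT t|lebesgue. norm (r t)) * c"
proof -
  have "norm (primitive k x) \<le> (LINT t|lebesgue. norm (r t) * c)"
    unfolding primitive_def set_lebesgue_integral_def
  proof (rule Bochner_Integration.integral_norm_bound_integral)
    show "integrable lebesgue (\<lambda>t. indicat_real {..x} t *\<^sub>R k t)"
      using k by (intro integrable_mult_indicator) auto
  qed (use r le c in \<open>auto simp: indicator_def\<close>)
  then show ?thesis by simp
qed

text \<open>Vanishing outside the open interval is required at every point, so that integrands can
  be compared pointwise rather than almost everywhere.\<close>

definition delay_coeff :: "real \<Rightarrow> (real \<Rightarrow> complex) \<Rightarrow> bool" where
  "delay_coeff a r \<longleftrightarrow> integrable lebesgue r \<and> (\<forall>x. x \<notin> {a<..<pi} \<longrightarrow> r x = 0)"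

text \<open>Successive approximations for \<open>exp (- \<i> lam x) w x\<close>, where \<open>\<alpha>\<close> and \<open>\<beta>\<close> are the values of \<open>w\<close> and \<open>v\<close>
  at 0. Since \<open>v\<close> solves the same system with \<open>r\<close> and \<open>s\<close> exchanged and \<open>lam\<close> negated, one function
  serves for both components. The iteration is stationary on \<open>[0, pi]\<close> as soon as \<open>n a \<ge> pi\<close>.\<close>

primrec picard :: "real \<Rightarrow> nat \<Rightarrow> (real \<Rightarrow> complex) \<Rightarrow> (real \<Rightarrow> complex) \<Rightarrow> complex \<Rightarrow> complex \<Rightarrow>
    complex \<Rightarrow> real \<Rightarrow> complex" where
  "picard a 0 r s \<alpha> \<beta> lam x = \<alpha>"
| "picard a (Suc n) r s \<alpha> \<beta> lam x = \<alpha> +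
     primitive (\<lambda>t. r t * (exp (- \<i> * lam * of_real (2 * t - a)) * picard a n s r \<beta> \<alpha> (- lam) (t - a))) x"

text \<open>Symmetric under the exchange of \<open>r\<close> with \<open>s\<close> and \<alpha> with
  \<beta>, so that one quantity survives the induction, in which every step performs this
  exchange.\<close>

definition picard_bound ::
    "nat \<Rightarrow> (real \<Rightarrow> complex) \<Rightarrow> (real \<Rightarrow> complex) \<Rightarrow> complex \<Rightarrow> complex \<Rightarrow> real" where
  "picard_bound n r s \<alpha> \<beta> =
     (norm \<alpha> + norm \<beta>) * (1 + (LINT t|lebesgue. norm (r t)) + (LINT t|lebesgue. norm (s t))) ^ n"

lemma picard_bound_commute: "picard_bound n r s \<alpha> \<beta> = picard_bound n s r \<beta> \<alpha>"
  by (simp add: picard_bound_def add_ac)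

lemma picard_bound_nonneg: "0 \<le> picard_bound n r s \<alpha> \<beta>"
  unfolding picard_bound_def by (intro mult_nonneg_nonneg zero_le_power add_nonneg_nonneg) auto

text \<open>The recursion behind the growth estimate; the summand 1 in the base of the power absorbs
  \<open>norm \<alpha>\<close>.\<close>

lemma picard_bound_Suc:
  "norm \<alpha> + (LINT t|lebesgue. norm (r t)) * picard_bound n r s \<alpha> \<beta> \<le> picard_bound (Suc n) r s \<alpha> \<beta>"
proof -
  define R S where "R = (LINT t|lebesgue. norm (r t))" and "S = (LINT t|lebesgue. norm (s t))"
  have R: "0 \<le> R" "0 \<le> S" by (simp_all add: R_def S_def)
  then have "1 \<le> (1 + R + S) ^ n" by (intro one_le_power) auto
  then have "(norm \<alpha> + norm \<beta>) * 1 \<le> picard_bound n r s \<alpha> \<beta>"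
    unfolding picard_bound_def R_def[symmetric] S_def[symmetric] by (intro mult_left_mono) auto
  moreover have "picard_bound (Suc n) r s \<alpha> \<beta> = (1 + R + S) * picard_bound n r s \<alpha> \<beta>"
    by (simp add: picard_bound_def R_def S_def)
  moreover have "0 \<le> S * picard_bound n r s \<alpha> \<beta>" by (intro mult_nonneg_nonneg R picard_bound_nonneg)
  moreover have "0 \<le> norm \<beta>" by simp
  ultimately show ?thesis unfolding R_def[symmetric] distrib_right mult_1 by linarith
qed

text \<open>With \<open>\<mu> = Im lam\<close> the exponents of the kernel and of \<open>P\<close>,
  which belongs to \<open>- lam\<close>, are added. For \<open>\<mu> \<ge> 0\<close> the sum is
  \<open>\<mu> * (2 * t - a)\<close>, at most \<open>2 * \<mu> * x - \<mu> * a\<close>; for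
  \<open>\<mu> < 0\<close> the variable \<open>t\<close> cancels and \<open>\<mu> * a\<close> is
  left. Both cases show the gain \<open>- \<bar>\<mu>\<bar> * a\<close>.\<close>

lemma norm_picard_kernel_le:
  assumes r: "delay_coeff a r" and tx: "t \<le> x" and a: "0 < a"
    and P: "norm (P) \<le> K * exp (2 * max (Im (- lam)) 0 * max (t - a) 0)" and K: "0 \<le> K"
  shows "norm (r t * (exp (- \<i> * lam * of_real (2 * t - a)) * P))
    \<le> norm (r t) * (K * exp (2 * max (Im lam) 0 * max x 0 - \<bar>Im lam\<bar> * a))"
proof (cases "t \<in> {a<..<pi}")
  case True
  define \<mu> where "\<mu> = Im lam"
  have "norm (exp (- \<i> * lam * of_real (2 * t - a)) * P)
      \<le> exp (\<mu> * (2 * t - a)) * (K * exp (2 * max (- \<mu>) 0 * max (t - a) 0))"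
    unfolding norm_mult by (intro mult_mono) (use P in \<open>auto simp: \<mu>_def\<close>)
  also have "\<dots> = K * exp (\<mu> * (2 * t - a) + 2 * max (- \<mu>) 0 * (t - a))"
    using True by (simp add: exp_add)
  also have "\<dots> \<le> K * exp (2 * max \<mu> 0 * max x 0 - \<bar>\<mu>\<bar> * a)"
  proof (intro mult_left_mono K, simp only: exp_le_cancel_iff)
    show "\<mu> * (2 * t - a) + 2 * max (- \<mu>) 0 * (t - a) \<le> 2 * max \<mu> 0 * max x 0 - \<bar>\<mu>\<bar> * a"
    proof (cases "0 \<le> \<mu>")
      case m: True
      have "\<mu> * t \<le> \<mu> * x" using tx m by (rule mult_left_mono)
      then show ?thesis using m True tx a by (simp add: algebra_simps max_def)
    qed (simp add: algebra_simps)
  qed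
  finally have "norm (exp (- \<i> * lam * of_real (2 * t - a)) * P)
      \<le> K * exp (2 * max \<mu> 0 * max x 0 - \<bar>\<mu>\<bar> * a)" .
  then show ?thesis unfolding norm_mult[of "r t"] \<mu>_def by (intro mult_left_mono) auto
qed (use r in \<open>simp add: delay_coeff_def\<close>)

lemma integrable_picard_kernel:
  assumes r: "delay_coeff a r" and P: "continuous_on UNIV P"
  shows "integrable lebesgue (\<lambda>t. r t * (exp (- \<i> * lam * of_real (2 * t - a)) * P (t - a)))"
proof -
  have c: "continuous_on UNIV (\<lambda>t. exp (- \<i> * lam * of_real (2 * t - a)) * P (t - a))"
    by (intro continuous_intros continuous_on_compose2[OF P]) auto
  then have "bounded ((\<lambda>t. exp (- \<i> * lam * of_real (2 * t - a)) * P (t - a)) ` {a..pi})"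
    by (intro compact_imp_bounded compact_continuous_image) (auto intro: continuous_on_subset)
  then obtain K where K: "\<And>t. t \<in> {a..pi} \<Longrightarrow> norm (exp (- \<i> * lam * of_real (2 * t - a)) * P (t - a)) \<le> K"
    unfolding bounded_iff by blast
  show ?thesis
    using r c
    by (intro integrable_times_bounded_on_support[where S = "{a<..<pi}" and K = K] K borel_measurable_continuous_onI)
      (auto simp: delay_coeff_def)
qed

section \<open>Growth, analyticity and stationarity of the approximations\<close>

context
  fixes a :: real
  assumes a: "0 < a"
begin

text \<open>Both claims share one induction, since the estimate of the primitive presupposes an
  integrable kernel, which comes from continuity of the previous iterate. The factor 2 in the
  exponent reflects the normalisation: a free wave \<open>exp (- \<i> * lam * x)\<close> is
  multiplied once more by the same exponential.\<close>

lemma picard_continuous_bounded: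
  assumes "delay_coeff a r" "delay_coeff a s"
  shows "continuous_on UNIV (picard a n r s \<alpha> \<beta> lam) \<and>
    (\<forall>x. norm (picard a n r s \<alpha> \<beta> lam x) \<le> picard_bound n r s \<alpha> \<beta> * exp (2 * max (Im lam) 0 * max x 0))"
  using assms
proof (induction n arbitrary: r s \<alpha> \<beta> lam)
  case 0
  have "norm \<alpha> \<le> (norm \<alpha> + norm \<beta>) * exp (2 * max (Im lam) 0 * max x 0)" for x
  proof -
    have "1 \<le> exp (2 * max (Im lam) 0 * max x 0)" by simp
    then have "norm \<alpha> * 1 \<le> (norm \<alpha> + norm \<beta>) * exp (2 * max (Im lam) 0 * max x 0)"
      by (intro mult_mono) auto
    then show ?thesis by simp
  qed
  then show ?case by (auto simp: picard_bound_def)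
next
  case (Suc n)
  let ?P = "picard a n s r \<beta> \<alpha> (- lam)"
  let ?k = "\<lambda>t. r t * (exp (- \<i> * lam * of_real (2 * t - a)) * ?P (t - a))"
  note IH = Suc.IH[OF Suc.prems(2,1), of \<beta> \<alpha> "- lam", unfolded picard_bound_commute[of n s r]]
  have ki: "integrable lebesgue ?k" by (rule integrable_picard_kernel[OF Suc.prems(1) IH[THEN conjunct1]])
  have pe: "picard a (Suc n) r s \<alpha> \<beta> lam = (\<lambda>x. \<alpha> + primitive ?k x)" by (rule ext) simp
  have "norm (picard a (Suc n) r s \<alpha> \<beta> lam x) \<le> picard_bound (Suc n) r s \<alpha> \<beta> * exp (2 * max (Im lam) 0 * max x 0)" for x
  proof -
    define R K E where "R = (LINT t|lebesgue. norm (r t))" and "K = picard_bound n r s \<alpha> \<beta>"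
      and "E = exp (2 * max (Im lam) 0 * max x 0)"
    have E: "1 \<le> E" by (simp add: E_def)
    have K: "0 \<le> K" by (simp add: K_def picard_bound_nonneg)
    have R: "0 \<le> R" by (simp add: R_def)
    have "norm (primitive ?k x) \<le> R * (K * exp (2 * max (Im lam) 0 * max x 0 - \<bar>Im lam\<bar> * a))"
      unfolding R_def
    proof (rule norm_primitive_le[OF ki])
      show "norm (?k t) \<le> norm (r t) * (K * exp (2 * max (Im lam) 0 * max x 0 - \<bar>Im lam\<bar> * a))" if "t \<le> x" for t
        unfolding K_def
        by (rule norm_picard_kernel_le[OF Suc.prems(1) that a IH[THEN conjunct2, rule_format] picard_bound_nonneg])
    qed (use Suc.prems K in \<open>auto simp: delay_coeff_def\<close>)
    also have "\<dots> \<le> R * (K * E)"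
      using a K R by (intro mult_left_mono) (auto simp: E_def)
    finally have "norm (picard a (Suc n) r s \<alpha> \<beta> lam x) \<le> norm \<alpha> * 1 + R * (K * E)"
      unfolding pe by (intro order_trans[OF norm_triangle_ineq]) simp
    also have "\<dots> \<le> norm \<alpha> * E + R * (K * E)" using E by (intro add_right_mono mult_left_mono) auto
    also have "\<dots> = (norm \<alpha> + R * K) * E" by (simp add: algebra_simps)
    also have "\<dots> \<le> picard_bound (Suc n) r s \<alpha> \<beta> * E"
      unfolding R_def K_def using E by (intro mult_right_mono picard_bound_Suc) auto
    finally show ?thesis by (simp add: E_def)
  qed
  moreover have "continuous_on UNIV (picard a (Suc n) r s \<alpha> \<beta> lam)"
    unfolding pe by (intro continuous_intros continuous_on_primitive ki)
  ultimately show ?case by blast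
qed

lemma integrable_picard:
  assumes "delay_coeff a r" "delay_coeff a s"
  shows "integrable lebesgue (\<lambda>t. r t * (exp (- \<i> * lam * of_real (2 * t - a)) * picard a n s r \<beta> \<alpha> (- lam) (t - a)))"
  by (rule integrable_picard_kernel[OF assms(1) picard_continuous_bounded[OF assms(2,1), THEN conjunct1]])

lemma norm_picard_integrand_le:
  assumes "delay_coeff a r" "delay_coeff a s" "t \<le> x"
  shows "norm (r t * (exp (- \<i> * lam * of_real (2 * t - a)) * picard a n s r \<beta> \<alpha> (- lam) (t - a)))
    \<le> norm (r t) * (picard_bound n r s \<alpha> \<beta> * exp (2 * max (Im lam) 0 * max x 0 - \<bar>Im lam\<bar> * a))"
  by (rule norm_picard_kernel_le[OF assms(1,3) a
        picard_continuous_bounded[OF assms(2,1), of n \<beta> \<alpha> "- lam", unfolded picard_bound_commute[of n s r], THEN conjunct2, rule_format]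
        picard_bound_nonneg])

text \<open>Everything beyond the initial value has passed through a delay. The estimate serves
  twice: to compare the solution with the free one at \<open>pi\<close>, and to bound the remainder
  in the descent on the support.\<close>

lemma norm_picard_Suc_diff_le:
  assumes r: "delay_coeff a r" and s: "delay_coeff a s"
  shows "norm (picard a (Suc n) r s \<alpha> \<beta> lam x - \<alpha>)
    \<le> (LINT t|lebesgue. norm (r t)) *
      (picard_bound n r s \<alpha> \<beta> * exp (2 * max (Im lam) 0 * max x 0 - \<bar>Im lam\<bar> * a))"
  unfolding picard.simps add_diff_cancel_left'
proof (rule norm_primitive_le)
  show "integrable lebesgue r" using r by (simp add: delay_coeff_def)
qed (rule integrable_picard[OF r s] norm_picard_integrand_le[OF r s] mult_nonneg_nonneg picard_bound_nonneg
    exp_ge_zero | assumption)+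

lemma picard_holomorphic:
  assumes "delay_coeff a r" "delay_coeff a s"
  shows "(\<lambda>lam. picard a n r s \<alpha> \<beta> lam x) holomorphic_on UNIV"
  using assms
proof (induction n arbitrary: r s \<alpha> \<beta> x)
  case (Suc n)
  let ?k = "\<lambda>lam t. r t * (exp (- \<i> * lam * of_real (2 * t - a)) * picard a n s r \<beta> \<alpha> (- lam) (t - a))"
  have k: "(\<lambda>lam. ?k lam t) holomorphic_on UNIV" for t
  proof -
    have "((\<lambda>lam. picard a n s r \<beta> \<alpha> lam (t - a)) \<circ> uminus) holomorphic_on UNIV"
      using Suc by (intro holomorphic_on_compose holomorphic_intros) (auto intro: holomorphic_on_subset)
    then show ?thesis by (auto simp: comp_def intro!: holomorphic_intros)
  qed
  have "(\<lambda>lam. primitive (?k lam) x) holomorphic_on UNIV"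
    unfolding primitive_def set_lebesgue_integral_def
  proof (rule integral_holomorphic_on_UNIV)
    show "(\<lambda>lam. indicat_real {..x} t *\<^sub>R ?k lam t) holomorphic_on UNIV" for t
      unfolding scaleR_conv_of_real by (rule holomorphic_on_mult[OF holomorphic_on_const k])
    show "(\<lambda>t. indicat_real {..x} t *\<^sub>R ?k lam t) \<in> borel_measurable lebesgue" for lam
      using Suc.prems by (intro borel_measurable_integrable integrable_mult_indicator integrable_picard) auto
    fix R
    show "\<exists>g. integrable lebesgue g \<and> (\<forall>lam t. norm lam \<le> R \<longrightarrow> norm (indicat_real {..x} t *\<^sub>R ?k lam t) \<le> g t)"
    proof (intro exI conjI allI impI)
      show "integrable lebesgue (\<lambda>t. norm (r t) * (picard_bound n r s \<alpha> \<beta> * exp (2 * R * max x 0)))"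
        using Suc.prems by (intro integrable_mult_left integrable_norm) (simp add: delay_coeff_def)
      fix lam :: complex and t assume lam: "norm lam \<le> R"
      have R: "\<bar>Im lam\<bar> \<le> R" using abs_Im_le_cmod[of lam] lam by linarith
      show "norm (indicat_real {..x} t *\<^sub>R ?k lam t) \<le> norm (r t) * (picard_bound n r s \<alpha> \<beta> * exp (2 * R * max x 0))"
      proof (cases "t \<le> x")
        case True
        have "2 * max (Im lam) 0 * max x 0 \<le> 2 * R * max x 0"
          using R by (intro mult_right_mono) auto
        moreover have "0 \<le> \<bar>Im lam\<bar> * a" using a by simp
        ultimately have "exp (2 * max (Im lam) 0 * max x 0 - \<bar>Im lam\<bar> * a) \<le> exp (2 * R * max x 0)"
          by simp
        then have "norm (r t) * (picard_bound n r s \<alpha> \<beta> * exp (2 * max (Im lam) 0 * max x 0 - \<bar>Im lam\<bar> * a))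
           \<le> norm (r t) * (picard_bound n r s \<alpha> \<beta> * exp (2 * R * max x 0))"
          by (intro mult_left_mono picard_bound_nonneg norm_ge_zero)
        with norm_picard_integrand_le[OF Suc.prems True, of lam n \<beta> \<alpha>] True show ?thesis by simp
      qed (simp add: picard_bound_nonneg)
    qed
  qed
  then show ?case by (auto intro!: holomorphic_intros)
qed simp

text \<open>The kernel looks at the previous iterate only at \<open>t - a\<close>, so agreement up
  to \<open>n * a\<close> yields agreement up to \<open>(n + 1) * a\<close>. Up to 0 the kernel
  vanishes, which starts the induction.\<close>

lemma picard_stable:
  assumes "delay_coeff a r" "delay_coeff a s" "x \<le> real n * a"
  shows "picard a (Suc n) r s \<alpha> \<beta> lam x = picard a n r s \<alpha> \<beta> lam x"
  using assms
proof (induction n arbitrary: r s \<alpha> \<beta> lam x)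
  case 0
  then have "primitive (\<lambda>t. r t * (exp (- \<i> * lam * of_real (2 * t - a)) * \<beta>)) x = primitive (\<lambda>_. 0) x"
    using a by (intro primitive_cong) (auto simp: delay_coeff_def)
  then show ?case by (simp add: primitive_def)
next
  case (Suc n)
  have "picard a (Suc n) s r \<beta> \<alpha> (- lam) (t - a) = picard a n s r \<beta> \<alpha> (- lam) (t - a)" if "t \<le> x" for t
    using Suc.prems that by (intro Suc.IH) (auto simp: algebra_simps)
  then show ?case
    unfolding picard.simps(2)[of a n] picard.simps(2)[of a "Suc n"]
    by (intro arg_cong2[where f = "(+)"] refl primitive_cong) (simp only:)
qed

end

section \<open>The initial value problem\<close>

lemma absolutely_continuous_on_subset:
  "absolutely_continuous_on S f \<Longrightarrow> T \<subseteq> S \<Longrightarrow> absolutely_continuous_on T f"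
  unfolding absolutely_continuous_on_def by (meson order_trans)

lemma absolutely_continuous_on_const: "absolutely_continuous_on S (\<lambda>_. c)"
  by (rule absolutely_continuous_on_lipschitz[where L = 0]) simp

lemma absolutely_continuous_on_component:
  fixes y :: "real \<Rightarrow> complex^2"
  assumes "absolutely_continuous_on S y"
  shows "absolutely_continuous_on S (\<lambda>x. y x $ i)"
  by (rule absolutely_continuous_on_dominated[OF assms])
    (simp add: Finite_Cartesian_Product.norm_nth_le flip: vector_minus_component)

lemma absolutely_continuous_on_vec2:
  fixes y :: "real \<Rightarrow> complex^2"
  assumes "absolutely_continuous_on S (\<lambda>x. y x $ 1)" "absolutely_continuous_on S (\<lambda>x. y x $ 2)"
  shows "absolutely_continuous_on S y"
proof (rule absolutely_continuous_on_dominated2[OF assms, of 1])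
  fix u v
  show "norm (y v - y u) \<le> 1 * norm (y v $ 1 - y u $ 1) + 1 * norm (y v $ 2 - y u $ 2)"
    using L2_set_le_sum[of UNIV "\<lambda>i. norm ((y v - y u) $ i)"]
    by (simp add: norm_vec_def sum_2)
qed simp

lemma exp_has_vector_derivative:
  "((\<lambda>x. exp (c * complex_of_real x)) has_vector_derivative c * exp (c * of_real x)) (at x)"
  by (rule has_vector_derivative_real_field) (auto intro!: derivative_eq_intros)

lemma absolutely_continuous_on_exp: "absolutely_continuous_on {a..b} (\<lambda>x. exp (c * complex_of_real x))"
  by (rule absolutely_continuous_on_C1[OF exp_has_vector_derivative]) (intro continuous_intros)

text \<open>The coordinates diagonalise \<open>matB\<close>, whose eigenvalues are
  \<open>\<i>\<close> and \<open>- \<i>\<close>; in them the potential couples each component only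
  to the other one. The variable \<open>z\<close> stands for the delayed value.\<close>

lemma delay_equation_iff:
  "matB *v y' + (if x < a then 0 else matQ p q x *v z) = lam *s y \<longleftrightarrow>
    y' $ 1 + \<i> * y' $ 2 = \<i> * lam * (y $ 1 + \<i> * y $ 2)
      + (if x < a then 0 else q x - \<i> * p x) * (z $ 1 - \<i> * z $ 2) \<and>
    y' $ 1 - \<i> * y' $ 2 = - \<i> * lam * (y $ 1 - \<i> * y $ 2)
      + (if x < a then 0 else q x + \<i> * p x) * (z $ 1 + \<i> * z $ 2)"
proof -
  define P Q where "P = (if x < a then 0 else p x)" and "Q = (if x < a then 0 else q x)"
  \<comment> \<open>The right-hand sides of the equation solved for the two components of
    \<open>y'\<close>.\<close>
  define A B where "A = - lam * y $ 2 + (Q * z $ 1 - P * z $ 2)" and "B = lam * y $ 1 - (P * z $ 1 + Q * z $ 2)"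
  have "matB *v y' + (if x < a then 0 else matQ p q x *v z) = lam *s y \<longleftrightarrow> y' $ 2 = B \<and> y' $ 1 = A"
    by (auto simp: matB_def matQ_def vec_eq_iff forall_2 matrix_vector_mult_def sum_2 A_def B_def P_def Q_def
        algebra_simps eq_neg_iff_add_eq_0 eq_diff_eq)
  also have "\<dots> \<longleftrightarrow> y' $ 1 + \<i> * y' $ 2 = A + \<i> * B \<and> y' $ 1 - \<i> * y' $ 2 = A - \<i> * B"
  proof
    assume h: "y' $ 1 + \<i> * y' $ 2 = A + \<i> * B \<and> y' $ 1 - \<i> * y' $ 2 = A - \<i> * B"
    have "2 * y' $ 1 = (y' $ 1 + \<i> * y' $ 2) + (y' $ 1 - \<i> * y' $ 2)" by simp
    also have "\<dots> = 2 * A" using h by simp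
    finally have "y' $ 1 = A" by simp
    then show "y' $ 2 = B \<and> y' $ 1 = A" using h by simp
  qed simp
  also have "A + \<i> * B = \<i> * lam * (y $ 1 + \<i> * y $ 2)
      + (if x < a then 0 else q x - \<i> * p x) * (z $ 1 - \<i> * z $ 2)"
    by (auto simp: A_def B_def P_def Q_def algebra_simps)
  also have "A - \<i> * B = - \<i> * lam * (y $ 1 - \<i> * y $ 2)
      + (if x < a then 0 else q x + \<i> * p x) * (z $ 1 + \<i> * z $ 2)"
    by (auto simp: A_def B_def P_def Q_def algebra_simps)
  finally show ?thesis .
qed

section \<open>Uniqueness for the initial value problem\<close>

lemma delay_dirac_solution_diff:
  assumes "delay_dirac_solution a p q lam y" "delay_dirac_solution a p q lam z"
  shows "delay_dirac_solution a p q lam (\<lambda>x. y x - z x)"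
  unfolding delay_dirac_solution_def
proof
  show "absolutely_continuous_on {0..pi} (\<lambda>x. y x - z x)"
  proof (rule absolutely_continuous_on_dominated2[of _ y z 1])
    fix u v
    show "norm (y v - z v - (y u - z u)) \<le> 1 * norm (y v - y u) + 1 * norm (z v - z u)"
      using norm_triangle_ineq4[of "y v - y u" "z v - z u"] by (simp add: algebra_simps)
  qed (use assms in \<open>auto simp: delay_dirac_solution_def\<close>)
  have *: "(AE x\<in>{0<..<pi} in lebesgue. \<exists>y'. (y has_vector_derivative y') (at x) \<and>
             matB *v y' + (if x < a then 0 else matQ p q x *v y (x - a)) = lam *s y x)"
    "(AE x\<in>{0<..<pi} in lebesgue. \<exists>y'. (z has_vector_derivative y') (at x) \<and>
             matB *v y' + (if x < a then 0 else matQ p q x *v z (x - a)) = lam *s z x)"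
    using assms by (auto simp: delay_dirac_solution_def)
  show "AE x\<in>{0<..<pi} in lebesgue. \<exists>y'. ((\<lambda>x. y x - z x) has_vector_derivative y') (at x) \<and>
             matB *v y' + (if x < a then 0 else matQ p q x *v (y (x - a) - z (x - a))) = lam *s (y x - z x)"
    using *
  proof eventually_elim
    case (elim x)
    show ?case
    proof
      assume "x \<in> {0<..<pi}"
      then obtain y' z' where d: "(y has_vector_derivative y') (at x)" "(z has_vector_derivative z') (at x)"
        and e: "matB *v y' + (if x < a then 0 else matQ p q x *v y (x - a)) = lam *s y x"
          "matB *v z' + (if x < a then 0 else matQ p q x *v z (x - a)) = lam *s z x"
        using elim by blast
      have "matB *v (y' - z') + (if x < a then 0 else matQ p q x *v (y (x - a) - z (x - a))) = lam *s (y x - z x)"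
        unfolding vector_ssub_ldistrib e[symmetric] by (simp add: matrix_vector_mult_diff_distrib)
      then show "\<exists>y'. ((\<lambda>x. y x - z x) has_vector_derivative y') (at x) \<and>
             matB *v y' + (if x < a then 0 else matQ p q x *v (y (x - a) - z (x - a))) = lam *s (y x - z x)"
        using has_vector_derivative_diff[OF d] by blast
    qed
  qed
qed

text \<open>Method of steps: once \<open>y\<close> vanishes up to \<open>n * a\<close>, the delayed
  term vanishes up to \<open>(n + 1) * a\<close>. There the diagonal components divided by their
  exponentials have derivative 0 almost everywhere, and absolute continuity makes them
  constant.\<close>

lemma delay_dirac_solution_zero:
  assumes y: "delay_dirac_solution a p q lam y" and y0: "y 0 = 0" and a: "0 < a" and x: "x \<in> {0..pi}"
  shows "y x = 0"
proof -
  have ac: "absolutely_continuous_on {0..pi} y"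
    and ae: "AE x\<in>{0<..<pi} in lebesgue. \<exists>y'. (y has_vector_derivative y') (at x) \<and>
             matB *v y' + (if x < a then 0 else matQ p q x *v y (x - a)) = lam *s y x"
    using y by (auto simp: delay_dirac_solution_def)
  have "\<forall>x\<in>{0..pi}. x \<le> real n * a \<longrightarrow> y x = 0" for n
  proof (induction n)
    case 0
    then show ?case using y0 by auto
  next
    case (Suc n)
    show ?case
    proof (intro ballI impI)
      fix x assume x: "x \<in> {0..pi}" "x \<le> real (Suc n) * a"
      have "y x $ 1 + c * y x $ 2 = 0" if c: "c = \<i> \<or> c = - \<i>" for c
      proof -
        let ?D = "\<lambda>t. exp (- c * lam * of_real t) * (y t $ 1 + c * y t $ 2)"
        have "?D x = ?D 0"
        proof (rule absolutely_continuous_on_zero_deriv[where f = ?D])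
          show "absolutely_continuous_on {0..x} ?D"
            using x absolutely_continuous_on_subset[OF absolutely_continuous_on_component[OF ac]]
            by (intro absolutely_continuous_on_mult absolutely_continuous_on_add absolutely_continuous_on_const
                absolutely_continuous_on_exp) auto
          show "AE t\<in>{0<..<x} in lebesgue. (?D has_vector_derivative 0) (at t)"
            using ae
          proof (rule eventually_mono, intro impI)
            fix t assume h: "t \<in> {0<..<pi} \<longrightarrow> (\<exists>y'. (y has_vector_derivative y') (at t) \<and>
             matB *v y' + (if t < a then 0 else matQ p q t *v y (t - a)) = lam *s y t)" and t: "t \<in> {0<..<x}"
            obtain y' where d: "(y has_vector_derivative y') (at t)" and
              e: "matB *v y' + (if t < a then 0 else matQ p q t *v y (t - a)) = lam *s y t"
              using h t x by auto
            have z: "y (t - a) = 0" if "a \<le> t"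
            proof -
              have "t - a \<in> {0..pi}" "t - a \<le> real n * a" using t x that a by (auto simp: algebra_simps)
              then show ?thesis using Suc.IH by blast
            qed
            have "y' $ 1 + c * y' $ 2 = c * lam * (y t $ 1 + c * y t $ 2)"
              using e c z unfolding delay_equation_iff by (auto split: if_splits)
            moreover have "((\<lambda>x. y x $ i) has_vector_derivative y' $ i) (at t)" for i
              using d exhaust_2[of i] by (auto simp: has_vector_derivative_vec2)
            then have "(?D has_vector_derivative (exp (- c * lam * of_real t) * (y' $ 1 + c * y' $ 2)
               + - c * lam * exp (- c * lam * of_real t) * (y t $ 1 + c * y t $ 2))) (at t)"
              by (intro has_vector_derivative_mult exp_has_vector_derivative has_vector_derivative_add
                  has_vector_derivative_mult_right)
            ultimately show "(?D has_vector_derivative 0) (at t)" by simp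
          qed
        qed (use x in auto)
        then show ?thesis using y0 by simp
      qed
      from this[of \<i>] this[of "- \<i>"] have "y x $ 1 = 0 \<and> y x $ 2 = 0"
        by (simp add: add_eq_0_iff)
      then show "y x = 0" by (simp add: vec_eq_iff forall_2)
    qed
  qed
  moreover obtain n where "x / a \<le> real n" using real_arch_simple by blast
  ultimately show ?thesis using x a by (auto simp: divide_le_eq)
qed

text \<open>Undoes the normalisation of \<open>picard\<close>. For \<open>n * a \<ge> pi\<close>
  this is the component \<open>w\<close> on \<open>[0, pi]\<close>; the component \<open>v\<close>
  arises by exchanging \<open>r\<close> with \<open>s\<close> and \<alpha> with \<beta> and negating
  \<open>lam\<close>.\<close>

definition delay_wave :: "real \<Rightarrow> nat \<Rightarrow> (real \<Rightarrow> complex) \<Rightarrow> (real \<Rightarrow> complex) \<Rightarrow> complex \<Rightarrow> complex \<Rightarrow>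
    complex \<Rightarrow> real \<Rightarrow> complex" where
  "delay_wave a n r s \<alpha> \<beta> lam x = exp (\<i> * lam * of_real x) * picard a n r s \<alpha> \<beta> lam x"

text \<open>The coefficient \<open>r\<close> is obtained for \<open>c = - \<i>\<close>, \<open>s\<close> for \<open>c = \<i>\<close>.\<close>

definition potential_coeff :: "real \<Rightarrow> complex \<Rightarrow> (real \<Rightarrow> complex) \<Rightarrow> (real \<Rightarrow> complex) \<Rightarrow> real \<Rightarrow> complex" where
  "potential_coeff a c p q x = (if x \<in> {a<..<pi} then q x + c * p x else 0)"

lemma L2_on_imp_delay_coeff:
  assumes "L2_on {0<..<pi} p" "L2_on {0<..<pi} q" "0 < a"
  shows "delay_coeff a (potential_coeff a c p q)"
proof -
  have i: "integrable lebesgue (\<lambda>x. indicat_real {a<..<pi} x *\<^sub>R f x)" if f: "L2_on {0<..<pi} f" for f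
  proof -
    have "integrable (lebesgue_on {0<..<pi}) (\<lambda>x. 1 + (norm (f x))\<^sup>2)"
      using f finite_measure.integrable_const[OF finite_measure_lebesgue_on[of "{0<..<pi}"]]
      by (intro Bochner_Integration.integrable_add) (auto simp: L2_on_def)
    then have "integrable (lebesgue_on {0<..<pi}) f"
    proof (rule Bochner_Integration.integrable_bound)
      show "AE x in lebesgue_on {0<..<pi}. norm (f x) \<le> norm (1 + (norm (f x))\<^sup>2)"
      proof (rule AE_I2)
        fix x
        \<comment> \<open>For \<open>u = norm (f x)\<close> this is \<open>u * u - u + 1\<close>, so
          \<open>u\<close> is at most \<open>1 + u * u\<close> and square integrability on a bounded
          interval gives integrability.\<close>
        have "0 \<le> (norm (f x) - 1)\<^sup>2 + norm (f x)" by (intro add_nonneg_nonneg) auto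
        then show "norm (f x) \<le> norm (1 + (norm (f x))\<^sup>2)"
          by (simp add: power2_eq_square algebra_simps)
      qed
    qed (use f in \<open>simp add: L2_on_def\<close>)
    then have "integrable lebesgue (\<lambda>x. indicat_real {0<..<pi} x *\<^sub>R f x)"
      by (simp add: integrable_restrict_space)
    then have "integrable lebesgue (\<lambda>x. indicat_real {a<..<pi} x *\<^sub>R (indicat_real {0<..<pi} x *\<^sub>R f x))"
      by (rule integrable_mult_indicator[rotated]) simp
    also have "(\<lambda>x. indicat_real {a<..<pi} x *\<^sub>R (indicat_real {0<..<pi} x *\<^sub>R f x)) =
        (\<lambda>x. indicat_real {a<..<pi} x *\<^sub>R f x)"
      using assms(3) by (auto simp: indicator_def)
    finally show ?thesis .
  qed
  have "integrable lebesgue (\<lambda>x. indicat_real {a<..<pi} x *\<^sub>R q x + c * (indicat_real {a<..<pi} x *\<^sub>R p x))"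
    by (intro Bochner_Integration.integrable_add integrable_mult_right i assms)
  also have "(\<lambda>x. indicat_real {a<..<pi} x *\<^sub>R q x + c * (indicat_real {a<..<pi} x *\<^sub>R p x)) = potential_coeff a c p q"
    by (auto simp: potential_coeff_def indicator_def)
  finally show ?thesis
    unfolding delay_coeff_def by (intro conjI) (assumption | simp add: potential_coeff_def)+
qed

section \<open>Existence of the solution and its value at the right end point\<close>

context
  fixes a :: real and N :: nat
  assumes a: "0 < a" and N: "pi \<le> real N * a"
begin

lemma picard_fixed_point:
  assumes "delay_coeff a r" "delay_coeff a s" "x \<le> pi"
  shows "picard a N r s \<alpha> \<beta> lam x = \<alpha> +
     primitive (\<lambda>t. r t * (exp (- \<i> * lam * of_real (2 * t - a)) * picard a N s r \<beta> \<alpha> (- lam) (t - a))) x"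
  using picard_stable[OF a assms(1,2), of x N \<alpha> \<beta> lam] assms(3) N by simp

lemma delay_wave_absolutely_continuous:
  assumes "delay_coeff a r" "delay_coeff a s"
  shows "absolutely_continuous_on {0..pi} (delay_wave a N r s \<alpha> \<beta> lam)"
proof -
  let ?k = "\<lambda>t. r t * (exp (- \<i> * lam * of_real (2 * t - a)) * picard a N s r \<beta> \<alpha> (- lam) (t - a))"
  have "absolutely_continuous_on {0..pi} (picard a N r s \<alpha> \<beta> lam)"
  proof (rule absolutely_continuous_on_dominated)
    show "absolutely_continuous_on {0..pi} (primitive ?k)"
      by (intro absolutely_continuous_on_primitive integrable_picard[OF a] assms)
  qed (simp add: picard_fixed_point[OF assms])
  then show ?thesis
    unfolding delay_wave_def by (intro absolutely_continuous_on_mult absolutely_continuous_on_exp)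
qed

lemma delay_wave_has_vector_derivative:
  assumes "delay_coeff a r" "delay_coeff a s"
  shows "AE x\<in>{..<pi} in lebesgue. (delay_wave a N r s \<alpha> \<beta> lam has_vector_derivative
    \<i> * lam * delay_wave a N r s \<alpha> \<beta> lam x + r x * delay_wave a N s r \<beta> \<alpha> (- lam) (x - a)) (at x)"
proof -
  let ?k = "\<lambda>t. r t * (exp (- \<i> * lam * of_real (2 * t - a)) * picard a N s r \<beta> \<alpha> (- lam) (t - a))"
  have "AE x in lebesgue. (primitive ?k has_vector_derivative ?k x) (at x)"
    by (intro primitive_has_vector_derivative_AE integrable_picard[OF a] assms)
  then show ?thesis
  proof (rule eventually_mono, intro impI)
    fix x assume d: "(primitive ?k has_vector_derivative ?k x) (at x)" and x: "x \<in> {..<pi}"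
    have "((\<lambda>x. \<alpha> + primitive ?k x) has_vector_derivative ?k x) (at x)"
      using has_vector_derivative_add[OF has_vector_derivative_const d] by simp
    then have "(picard a N r s \<alpha> \<beta> lam has_vector_derivative ?k x) (at x)"
      by (rule has_vector_derivative_transform_within_open[of _ _ _ "{..<pi}"])
        (use x in \<open>auto simp only: picard_fixed_point[OF assms less_imp_le] lessThan_iff open_lessThan\<close>)
    from has_vector_derivative_mult[OF exp_has_vector_derivative this, of "\<i> * lam"]
    have "(delay_wave a N r s \<alpha> \<beta> lam has_vector_derivative
      exp (\<i> * lam * of_real x) * ?k x + \<i> * lam * exp (\<i> * lam * of_real x) * picard a N r s \<alpha> \<beta> lam x) (at x)"
      unfolding delay_wave_def .
    \<comment> \<open>The origin of the exponent \<open>2 * t - a\<close> in the kernel: one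
      \<open>t\<close> removes the factor of the wave itself, the remaining \<open>t - a\<close>
      restores that of the delayed wave for \<open>- lam\<close>.\<close>
    moreover have E: "exp (\<i> * lam * of_real x) * exp (- \<i> * lam * of_real (2 * x - a)) = exp (\<i> * (- lam) * of_real (x - a))"
      by (simp add: algebra_simps flip: exp_add)
    have k: "exp (\<i> * lam * of_real x) * ?k x = r x * delay_wave a N s r \<beta> \<alpha> (- lam) (x - a)"
      unfolding delay_wave_def E[symmetric] by (simp only: mult_ac)
    ultimately show "(delay_wave a N r s \<alpha> \<beta> lam has_vector_derivative
      \<i> * lam * delay_wave a N r s \<alpha> \<beta> lam x + r x * delay_wave a N s r \<beta> \<alpha> (- lam) (x - a)) (at x)"
      unfolding k by (simp only: delay_wave_def[of a N r s \<alpha> \<beta> lam x] mult.assoc add.commute)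
  qed
qed

text \<open>The waves give an explicit solution, so the choice operator picks some solution, and
  uniqueness transfers the value at \<open>pi\<close>. The initial vector \<open>(0, -1)\<close>
  becomes \<open>- \<i>\<close> for \<open>w\<close> and \<open>\<i>\<close> for
  \<open>v\<close>.\<close>

lemma solS_pi:
  assumes p: "L2_on {0<..<pi} p" and q: "L2_on {0<..<pi} q"
  defines "r \<equiv> potential_coeff a (- \<i>) p q" and "s \<equiv> potential_coeff a \<i> p q"
  shows "solS a p q lam pi = vector [
    (delay_wave a N r s (- \<i>) \<i> lam pi + delay_wave a N s r \<i> (- \<i>) (- lam) pi) / 2,
    (delay_wave a N r s (- \<i>) \<i> lam pi - delay_wave a N s r \<i> (- \<i>) (- lam) pi) / (2 * \<i>)]"
proof -
  have r: "delay_coeff a r" and s: "delay_coeff a s"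
    unfolding r_def s_def by (intro L2_on_imp_delay_coeff p q a)+
  define w v where "w = delay_wave a N r s (- \<i>) \<i> lam" and "v = delay_wave a N s r \<i> (- \<i>) (- lam)"
  define y :: "real \<Rightarrow> complex^2" where "y x = vector [(w x + v x) / 2, (w x - v x) / (2 * \<i>)]" for x
  have wv: "y x $ 1 + \<i> * y x $ 2 = w x" "y x $ 1 - \<i> * y x $ 2 = v x" for x
    by (simp_all add: y_def field_simps)
  have ac: "absolutely_continuous_on {0..pi} w" "absolutely_continuous_on {0..pi} v"
    unfolding w_def v_def by (intro delay_wave_absolutely_continuous r s)+
  have wd: "AE x\<in>{..<pi} in lebesgue. (w has_vector_derivative \<i> * lam * w x + r x * v (x - a)) (at x)"
    unfolding w_def v_def by (intro delay_wave_has_vector_derivative r s)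
  have vd: "AE x\<in>{..<pi} in lebesgue. (v has_vector_derivative - \<i> * lam * v x + s x * w (x - a)) (at x)"
    using delay_wave_has_vector_derivative[OF s r, of \<i> "- \<i>" "- lam"] unfolding w_def v_def by simp
  \<comment> \<open>At \<open>a\<close> itself the conventions differ:
    \<open>potential_coeff\<close> is 0 there, whereas the equation already contains the
    potential.\<close>
  have na: "AE x in lebesgue. x \<noteq> a"
    by (rule AE_I'[of "{a}"]) (auto simp: negligible_iff_null_sets[symmetric])
  have "delay_dirac_solution a p q lam y"
    unfolding delay_dirac_solution_def
  proof
    have "absolutely_continuous_on {0..pi} (\<lambda>x. 1 / 2 * w x + 1 / 2 * v x)"
      "absolutely_continuous_on {0..pi} (\<lambda>x. - \<i> / 2 * w x + \<i> / 2 * v x)"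
      by (intro absolutely_continuous_on_add absolutely_continuous_on_mult absolutely_continuous_on_const ac)+
    moreover have "(\<lambda>x. y x $ 1) = (\<lambda>x. 1 / 2 * w x + 1 / 2 * v x)"
        "(\<lambda>x. y x $ 2) = (\<lambda>x. - \<i> / 2 * w x + \<i> / 2 * v x)"
      by (auto simp: y_def field_simps)
    ultimately show "absolutely_continuous_on {0..pi} y"
      by (intro absolutely_continuous_on_vec2) (simp_all only:)
    show "AE x\<in>{0<..<pi} in lebesgue. \<exists>y'. (y has_vector_derivative y') (at x) \<and>
             matB *v y' + (if x < a then 0 else matQ p q x *v y (x - a)) = lam *s y x"
      using wd vd na
    proof eventually_elim
      case (elim x)
      show ?case
      proof
        assume x: "x \<in> {0<..<pi}"
        define w' v' where "w' = \<i> * lam * w x + r x * v (x - a)" and "v' = - \<i> * lam * v x + s x * w (x - a)"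
        have d: "(w has_vector_derivative w') (at x)" "(v has_vector_derivative v') (at x)"
          using elim x by (auto simp: w'_def v'_def)
        define y' :: "complex^2" where "y' = vector [(w' + v') / 2, (w' - v') / (2 * \<i>)]"
        have wv': "y' $ 1 + \<i> * y' $ 2 = w'" "y' $ 1 - \<i> * y' $ 2 = v'"
          by (simp_all add: y'_def field_simps)
        have "(y has_vector_derivative y') (at x)"
          unfolding has_vector_derivative_vec2 y_def y'_def
          by (auto intro!: has_vector_derivative_divide has_vector_derivative_minus
              has_vector_derivative_mult_right has_vector_derivative_add has_vector_derivative_diff d)
        moreover have "r x = (if x < a then 0 else q x - \<i> * p x)" "s x = (if x < a then 0 else q x + \<i> * p x)"
          using x elim(3) by (auto simp: r_def s_def potential_coeff_def)
        then have "matB *v y' + (if x < a then 0 else matQ p q x *v y (x - a)) = lam *s y x"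
          unfolding delay_equation_iff wv wv' w'_def v'_def by simp
        ultimately show "\<exists>y'. (y has_vector_derivative y') (at x) \<and>
             matB *v y' + (if x < a then 0 else matQ p q x *v y (x - a)) = lam *s y x" by blast
      qed
    qed
  qed
  moreover have "picard a N r s \<alpha> \<beta> lam 0 = \<alpha>" if "delay_coeff a r" "delay_coeff a s" for r s \<alpha> \<beta> lam
  proof -
    have "primitive (\<lambda>t. r t * (exp (- \<i> * lam * of_real (2 * t - a)) * picard a N s r \<beta> \<alpha> (- lam) (t - a))) 0
       = primitive (\<lambda>_. 0) 0"
      using a that by (intro primitive_cong) (auto simp: delay_coeff_def)
    then show ?thesis
      using picard_fixed_point[OF that, of 0] by (simp add: primitive_def)
  qed
  then have "y 0 = vector [0, -1]"
    using r s by (simp add: y_def w_def v_def delay_wave_def)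
  ultimately have y: "delay_dirac_solution a p q lam y" "y 0 = vector [0, -1]" by blast+
  then have "\<exists>y. delay_dirac_solution a p q lam y \<and> y 0 = vector [0, -1]" by blast
  then have S: "delay_dirac_solution a p q lam (solS a p q lam) \<and> solS a p q lam 0 = vector [0, -1]"
    unfolding solS_def by (rule someI_ex)
  have "solS a p q lam pi - y pi = 0"
    by (rule delay_dirac_solution_zero[OF delay_dirac_solution_diff[OF S[THEN conjunct1] y(1)] _ a, of pi])
      (simp_all add: S y)
  then show ?thesis by (simp add: y_def w_def v_def)
qed

end

section \<open>The inverse problem\<close>

text \<open>The function \<open>G\<close> in the proof is the part of the first order term with \<open>t > b - a / 2\<close>, normalised by
  \<open>exp (\<i> lam (2 b - 2 a))\<close>. It is trivially bounded in the lower half plane; in the upper one it equals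
  the negative of all the other terms, which the normalisation just compensates.\<close>

lemma picard_integral_zero_step:
  assumes a: "0 < a" and N: "pi \<le> real N * a" and r: "delay_coeff a r" and s: "delay_coeff a s" and \<beta>: "\<beta> \<noteq> 0"
    and zero: "\<And>lam. primitive (\<lambda>t. r t * (exp (- \<i> * lam * of_real (2 * t - a)) * picard a N s r \<beta> \<alpha> (- lam) (t - a))) pi = 0"
    and b: "AE t in lebesgue. b < t \<longrightarrow> r t = 0"
  shows "AE t in lebesgue. b - a / 2 < t \<longrightarrow> r t = 0"
proof -
  have ri: "integrable lebesgue r" and r0: "\<And>t. t \<notin> {a<..<pi} \<Longrightarrow> r t = 0"
    using r by (auto simp: delay_coeff_def)
  \<comment> \<open>A successor, because the bound for the deviation from the initial value concerns
    iterates that went through the recursion at least once.\<close>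
  obtain n where n: "N = Suc n" using N pi_gt_zero by (cases N) auto
  define L where "L = (LINT t|lebesgue. norm (s t)) * picard_bound n s r \<beta> \<alpha>"
  define M where "M = (LINT t|lebesgue. norm (r t))"
  have L: "0 \<le> L" unfolding L_def by (intro mult_nonneg_nonneg picard_bound_nonneg) simp
  have M: "0 \<le> M" by (simp add: M_def)
  define e where "e lam t = exp (- \<i> * lam * of_real (2 * t - a))" for lam t
  define P where "P lam t = picard a N s r \<beta> \<alpha> (- lam) (t - a)" for lam t
  have ne: "norm (e lam t) = exp (Im lam * (2 * t - a))" for lam t by (simp add: e_def)
  have P: "norm (P lam t - \<beta>) \<le> L * exp (- (Im lam * a))" if "0 \<le> Im lam" for lam t
    using norm_picard_Suc_diff_le[OF a s r, of n \<beta> \<alpha> "- lam" "t - a"] that by (simp add: P_def n L_def)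
  have rePi: "integrable lebesgue (\<lambda>t. r t * (e lam t * P lam t))" for lam
    unfolding e_def P_def by (rule integrable_picard[OF a r s])
  have reP: "(LINT t|lebesgue. r t * (e lam t * P lam t)) = 0" for lam
  proof -
    have "(LINT t|lebesgue. indicat_real {..pi} t *\<^sub>R (r t * (e lam t * P lam t))) = 0"
      using zero[of lam] by (simp only: primitive_def set_lebesgue_integral_def e_def P_def)
    also have "(\<lambda>t. indicat_real {..pi} t *\<^sub>R (r t * (e lam t * P lam t))) = (\<lambda>t. r t * (e lam t * P lam t))"
      using r0 by (auto simp: indicator_def)
    finally show ?thesis .
  qed
  define f where "f t = indicat_real {b - a / 2<..} t *\<^sub>R r t" for t
  have fi: "integrable lebesgue f" unfolding f_def by (rule integrable_mult_indicator[OF _ ri]) simp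
  have f0: "f t = 0" if "t \<notin> {a..pi}" for t using that r0[of t] by (auto simp: f_def)
  have fle: "norm (f t) \<le> norm (r t)" for t by (simp add: f_def indicator_def)
  have fci: "integrable lebesgue (\<lambda>t. f t * h t)" if "continuous_on UNIV h" for h
  proof -
    have "bounded (h ` {a..pi})"
      using that by (intro compact_imp_bounded compact_continuous_image) (auto intro: continuous_on_subset)
    then obtain K where K: "\<And>t. t \<in> {a..pi} \<Longrightarrow> norm (h t) \<le> K" unfolding bounded_iff by blast
    show ?thesis
      by (rule integrable_times_bounded_on_support[OF fi f0 borel_measurable_continuous_onI[OF that] K])
  qed
  define k where "k lam t = exp (- \<i> * lam * of_real (2 * t - 2 * b + a))" for lam t
  have kc: "continuous_on UNIV (k lam)" for lam unfolding k_def by (intro continuous_intros)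
  have ec: "continuous_on UNIV (e lam)" for lam unfolding e_def by (intro continuous_intros)
  have nk: "norm (k lam t) = exp (Im lam * (2 * t - 2 * b + a))" for lam t by (simp add: k_def)
  define G where "G lam = (LINT t|lebesgue. f t * k lam t)" for lam
  have fk: "norm (f t * k lam t) \<le> norm (r t)" if "Im lam \<le> 0" for lam t
  proof (cases "b - a / 2 < t")
    case True
    then have "Im lam * (2 * t - 2 * b + a) \<le> 0" using that by (intro mult_nonpos_nonneg) auto
    then have "norm (f t) * norm (k lam t) \<le> norm (r t) * 1" unfolding nk by (intro mult_mono fle) auto
    then show ?thesis by (simp add: norm_mult)
  qed (simp add: f_def)
  have lower: "norm (G lam) \<le> M" if "Im lam \<le> 0" for lam
    unfolding G_def M_def using ri fk[OF that]
    by (intro Bochner_Integration.integral_norm_bound_integral fci kc integrable_norm)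
  have upper: "norm (G lam) \<le> M * (L + norm \<beta>) / norm \<beta>" if \<mu>: "0 \<le> Im lam" for lam
  proof -
    \<comment> \<open>The common bound for two exponents: \<open>(2 * b - a) - a\<close> from the
      remainder on \<open>t \<le> b\<close>, and \<open>2 * (b - a / 2) - a\<close> from the first
      order term on \<open>t \<le> b - a / 2\<close>.\<close>
    define E where "E = exp (Im lam * (2 * b - 2 * a))"
    \<comment> \<open>The subtracted integral is 0. Writing \<open>P\<close> as
      \<open>\<beta>\<close> plus its deviation leaves just the two parts controlled by
      \<open>E\<close>.\<close>
    have "\<beta> * (LINT t|lebesgue. f t * e lam t)
        = (LINT t|lebesgue. \<beta> * (f t * e lam t)) - (LINT t|lebesgue. r t * (e lam t * P lam t))"
      by (simp add: reP)
    also have "\<dots> = (LINT t|lebesgue. \<beta> * (f t * e lam t) - r t * (e lam t * P lam t))"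
      by (intro Bochner_Integration.integral_diff[symmetric] rePi integrable_mult_right fci ec)
    also have "norm \<dots> \<le> (LINT t|lebesgue. norm (r t) * ((L + norm \<beta>) * E))"
    proof (rule order_trans[OF integral_norm_bound integral_mono_AE])
      show "AE t in lebesgue. norm (\<beta> * (f t * e lam t) - r t * (e lam t * P lam t)) \<le> norm (r t) * ((L + norm \<beta>) * E)"
        using b
      proof eventually_elim
        case (elim t)
        show ?case
        proof (cases "b < t")
          case False
          have "norm (e lam t * (P lam t - \<beta>)) \<le> exp (Im lam * (2 * b - a)) * (L * exp (- (Im lam * a)))"
            unfolding norm_mult ne using False \<mu> L by (intro mult_mono P) (auto intro!: mult_left_mono)
          also have "\<dots> = L * E" by (simp add: E_def algebra_simps flip: exp_add)
          finally have 1: "norm (e lam t * (P lam t - \<beta>)) \<le> L * E" .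
          have 2: "norm (of_bool (t \<le> b - a / 2) * \<beta> * e lam t) \<le> norm \<beta> * E"
          proof (cases "t \<le> b - a / 2")
            case True
            then have "2 * t - a \<le> 2 * b - 2 * a" by simp
            then have "Im lam * (2 * t - a) \<le> Im lam * (2 * b - 2 * a)" using \<mu> by (rule mult_left_mono)
            then show ?thesis using True by (simp add: norm_mult ne E_def mult_left_mono)
          qed (simp add: E_def)
          have "\<beta> * (f t * e lam t) - r t * (e lam t * P lam t)
            = - (r t * (e lam t * (P lam t - \<beta>) + of_bool (t \<le> b - a / 2) * \<beta> * e lam t))"
            by (simp add: f_def algebra_simps)
          also have "norm \<dots> \<le> norm (r t) * (L * E + norm \<beta> * E)"
            unfolding norm_minus_cancel norm_mult[of "r t"]
            by (intro mult_left_mono order_trans[OF norm_triangle_ineq] add_mono 1 2) simp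
          finally show ?thesis by (simp add: algebra_simps)
        qed (use elim in \<open>simp add: f_def\<close>)
      qed
    qed (use ri in \<open>auto intro!: Bochner_Integration.integrable_diff rePi integrable_mult_right fci ec\<close>)
    also have "\<dots> = M * (L + norm \<beta>) * E" by (simp add: M_def)
    finally have "norm \<beta> * norm (LINT t|lebesgue. f t * e lam t) \<le> M * (L + norm \<beta>) * E"
      by (simp only: norm_mult)
    then have le: "norm (LINT t|lebesgue. f t * e lam t) \<le> M * (L + norm \<beta>) * E / norm \<beta>"
      using \<beta> by (simp add: pos_le_divide_eq mult.commute)
    have "k lam t = exp (\<i> * lam * of_real (2 * b - 2 * a)) * e lam t" for t
      unfolding k_def e_def by (simp add: algebra_simps flip: exp_add)
    then have "G lam = (LINT t|lebesgue. exp (\<i> * lam * of_real (2 * b - 2 * a)) * (f t * e lam t))"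
      unfolding G_def by (intro Bochner_Integration.integral_cong refl) (simp only: mult_ac)
    then have "norm (G lam) = inverse E * norm (LINT t|lebesgue. f t * e lam t)"
      by (simp add: norm_mult E_def flip: exp_minus)
    also have "\<dots> \<le> inverse E * (M * (L + norm \<beta>) * E / norm \<beta>)"
      by (intro mult_left_mono le) (simp add: E_def)
    also have "\<dots> = M * (L + norm \<beta>) / norm \<beta>" by (simp add: E_def)
    finally show ?thesis .
  qed
  have "G holomorphic_on UNIV"
    unfolding G_def
  proof (rule integral_holomorphic_on_UNIV)
    show "(\<lambda>lam. f t * k lam t) holomorphic_on UNIV" for t unfolding k_def by (intro holomorphic_intros)
    show "(\<lambda>t. f t * k lam t) \<in> borel_measurable lebesgue" for lam
      by (intro borel_measurable_integrable fci kc)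
    fix R
    show "\<exists>g. integrable lebesgue g \<and> (\<forall>lam t. norm lam \<le> R \<longrightarrow> norm (f t * k lam t) \<le> g t)"
    proof (intro exI conjI allI impI)
      show "integrable lebesgue (\<lambda>t. norm (f t) * exp (R * (2 * pi + 2 * \<bar>b\<bar> + a)))"
        by (intro integrable_mult_left integrable_norm fi)
      fix lam :: complex and t assume lam: "norm lam \<le> R"
      show "norm (f t * k lam t) \<le> norm (f t) * exp (R * (2 * pi + 2 * \<bar>b\<bar> + a))"
      proof (cases "t \<in> {a..pi}")
        case True
        have "Im lam * (2 * t - 2 * b + a) \<le> \<bar>Im lam\<bar> * \<bar>2 * t - 2 * b + a\<bar>"
          by (metis abs_ge_self abs_mult)
        also have "\<dots> \<le> R * (2 * pi + 2 * \<bar>b\<bar> + a)"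
          using True a lam abs_Im_le_cmod[of lam] by (intro mult_mono) auto
        finally show ?thesis unfolding norm_mult nk by (intro mult_left_mono) auto
      qed (simp add: f0)
    qed
  qed
  moreover have "norm (G lam) \<le> max M (M * (L + norm \<beta>) / norm \<beta>)" for lam
    using lower[of lam] upper[of lam] by (cases "Im lam \<le> 0") auto
  ultimately have "G constant_on UNIV"
    by (intro Liouville_theorem boundedI[where B = "max M (M * (L + norm \<beta>) / norm \<beta>)"]) auto
  then obtain c where c: "\<And>lam. G lam = c" by (auto simp: constant_on_def)
  \<comment> \<open>Down the imaginary axis the integrand decays pointwise, because
    \<open>2 * t - 2 * b + a\<close> is positive wherever \<open>f\<close> can be nonzero; this
    identifies the constant as 0.\<close>
  have "(\<lambda>m. G (- \<i> * of_nat m)) \<longlonglongrightarrow> (LINT t|(lebesgue :: real measure). 0)"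
    unfolding G_def
  proof (rule integral_dominated_convergence[where w = "\<lambda>t. norm (r t)" and f = "\<lambda>_. 0"
        and s = "\<lambda>m t. f t * k (- \<i> * of_nat m) t"])
    show "(\<lambda>t. f t * k (- \<i> * of_nat m) t) \<in> borel_measurable lebesgue" for m
      by (intro borel_measurable_integrable fci kc)
    show "AE t in lebesgue. norm (f t * k (- \<i> * of_nat m) t) \<le> norm (r t)" for m
      by (intro AE_I2 fk) simp
    show "AE t in lebesgue. (\<lambda>m. f t * k (- \<i> * of_nat m) t) \<longlonglongrightarrow> 0"
    proof (rule AE_I2)
      fix t
      show "(\<lambda>m. f t * k (- \<i> * of_nat m) t) \<longlonglongrightarrow> 0"
      proof (cases "b - a / 2 < t")
        case True
        define y where "y = exp (- (2 * t - 2 * b + a))"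
        have "norm (k (- \<i> * of_nat m) t) = y ^ m" for m
          by (simp add: nk y_def algebra_simps flip: exp_of_nat_mult)
        moreover have "(\<lambda>m. y ^ m) \<longlonglongrightarrow> 0" using True by (intro LIMSEQ_realpow_zero) (auto simp: y_def)
        ultimately have "(\<lambda>m. norm (k (- \<i> * of_nat m) t)) \<longlonglongrightarrow> 0" by (simp only:)
        then have "(\<lambda>m. k (- \<i> * of_nat m) t) \<longlonglongrightarrow> 0" by (rule tendsto_norm_zero_cancel)
        then show ?thesis by (rule tendsto_mult_right_zero)
      qed (simp add: f_def)
    qed
  qed (use ri in auto)
  then have c0: "c = 0" by (simp add: c LIMSEQ_const_iff)
  have "AE t in lebesgue. f t = 0"
  proof (rule fourier_zero_imp_AE_zero[OF fi f0])
    fix lam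
    \<comment> \<open>Halving compensates the \<open>2 * t\<close> in the exponent; up to a
      nonvanishing factor independent of \<open>t\<close> the Fourier kernel appears.\<close>
    have k: "k (- lam / 2) t = exp (- \<i> * lam * of_real (b - a / 2)) * exp (\<i> * lam * of_real t)" for t
      unfolding k_def by (simp add: field_simps flip: exp_add)
    have "0 = (LINT t|lebesgue. f t * k (- lam / 2) t)" using c[of "- lam / 2"] c0 by (simp add: G_def)
    also have "\<dots> = (LINT t|lebesgue. exp (- \<i> * lam * of_real (b - a / 2)) * (f t * exp (\<i> * lam * of_real t)))"
      unfolding k by (intro Bochner_Integration.integral_cong refl) (simp only: mult_ac)
    finally show "(LINT t|lebesgue. f t * exp (\<i> * lam * of_real t)) = 0" by simp
  qed
  then show ?thesis by (rule eventually_mono) (auto simp: f_def)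
qed

lemma picard_integral_zero_imp_AE_zero:
  assumes a: "0 < a" and N: "pi \<le> real N * a" and r: "delay_coeff a r" and s: "delay_coeff a s" and \<beta>: "\<beta> \<noteq> 0"
    and zero: "\<And>lam. primitive (\<lambda>t. r t * (exp (- \<i> * lam * of_real (2 * t - a)) * picard a N s r \<beta> \<alpha> (- lam) (t - a))) pi = 0"
  shows "AE t in lebesgue. r t = 0"
proof -
  have step: "AE t in lebesgue. pi - real n * (a / 2) < t \<longrightarrow> r t = 0" for n
  proof (induction n)
    case 0
    then show ?case using r by (intro AE_I2) (auto simp: delay_coeff_def)
  next
    case (Suc n)
    have "pi - real (Suc n) * (a / 2) = pi - real n * (a / 2) - a / 2" by (simp add: algebra_simps add_divide_distrib)
    then show ?case by (simp only:) (rule picard_integral_zero_step[OF a N r s \<beta> zero Suc])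
  qed
  \<comment> \<open>Two half steps per delay: \<open>2 * N\<close> of them cover
    \<open>N * a \<ge> pi\<close>.\<close>
  have "pi - real (2 * N) * (a / 2) \<le> 0" using N by simp
  then have "r t = 0" if "pi - real (2 * N) * (a / 2) < t \<longrightarrow> r t = 0" for t
    using that r a by (cases "0 < t") (auto simp: delay_coeff_def)
  then show ?thesis using step[of "2 * N"] by (auto elim: eventually_mono)
qed

section \<open>From the spectra to vanishing integrals\<close>

lemma delay_wave_holomorphic:
  assumes "0 < a" "delay_coeff a r" "delay_coeff a s"
  shows "(\<lambda>lam. delay_wave a n r s \<alpha> \<beta> lam x) holomorphic_on UNIV"
  unfolding delay_wave_def by (intro holomorphic_intros picard_holomorphic assms)

text \<open>Stationarity allows \<open>N\<close> to be replaced by \<open>Suc N\<close>, so that the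
  delay factor becomes visible. Multiplication by the free wave then turns the one-sided growth
  \<open>2 * max (Im lam) 0 * pi\<close> into the symmetric
  \<open>\<bar>Im lam\<bar> * pi\<close>.\<close>

lemma norm_delay_wave_diff_le:
  assumes a: "0 < a" and N: "pi \<le> real N * a" and r: "delay_coeff a r" and s: "delay_coeff a s"
  shows "norm (delay_wave a N r s \<alpha> \<beta> lam pi - \<alpha> * exp (\<i> * lam * of_real pi))
    \<le> (LINT t|lebesgue. norm (r t)) * picard_bound N r s \<alpha> \<beta> * exp ((pi - a) * \<bar>Im lam\<bar>)"
proof -
  have "delay_wave a N r s \<alpha> \<beta> lam pi - \<alpha> * exp (\<i> * lam * of_real pi)
      = exp (\<i> * lam * of_real pi) * (picard a (Suc N) r s \<alpha> \<beta> lam pi - \<alpha>)"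
    using picard_stable[OF a r s N] by (simp add: delay_wave_def algebra_simps del: picard.simps)
  also have "norm \<dots> \<le> exp (- (Im lam * pi)) * ((LINT t|lebesgue. norm (r t)) *
      (picard_bound N r s \<alpha> \<beta> * exp (2 * max (Im lam) 0 * max pi 0 - \<bar>Im lam\<bar> * a)))"
    unfolding norm_mult by (intro mult_mono norm_picard_Suc_diff_le[OF a r s]) auto
  also have "\<dots> = (LINT t|lebesgue. norm (r t)) * picard_bound N r s \<alpha> \<beta> *
      exp (- (Im lam * pi) + (2 * max (Im lam) 0 * max pi 0 - \<bar>Im lam\<bar> * a))"
    by (simp only: exp_add mult_ac)
  also have "- (Im lam * pi) + (2 * max (Im lam) 0 * max pi 0 - \<bar>Im lam\<bar> * a) = (pi - a) * \<bar>Im lam\<bar>"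
    unfolding max_absorb1[OF pi_ge_zero] by (cases "0 \<le> Im lam") (auto simp: algebra_simps)
  finally show ?thesis .
qed

text \<open>Each free eigenvalue is listed exactly once, whereas a point where the characteristic
  function is nonzero has the default multiplicity 0.\<close>

lemma char_fun_free_eigenvalue:
  assumes "eigenvalue_sequence j a p q (free_eigenvalue j)"
  shows "char_fun j a p q (free_eigenvalue j n) = 0"
proof (rule ccontr)
  assume "char_fun j a p q (free_eigenvalue j n) \<noteq> 0"
  then have "card {m. free_eigenvalue j m = free_eigenvalue j n} = 0"
    using assms by (simp add: eigenvalue_sequence_def eigenvalue_mult_def)
  moreover have "{m. free_eigenvalue j m = free_eigenvalue j n} = {n}" by (auto simp: free_eigenvalue_def)
  ultimately show False by simp
qed

theorem theorem4p1:
  fixes a :: real and p q :: "real \<Rightarrow> complex" and ev :: "nat \<Rightarrow> int \<Rightarrow> complex"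
  assumes "0 < a" and "a < 2 * pi / 5"
    and "L2_on {0<..<pi} p" and "L2_on {0<..<pi} q"
    and "AE x\<in>{0<..<a} in lebesgue. p x = 0 \<and> q x = 0"
    and "\<And>j. j \<in> {1, 2} \<Longrightarrow> eigenvalue_sequence j a p q (ev j)"
    and "\<And>j n. j \<in> {1, 2} \<Longrightarrow> ev j n = free_eigenvalue j n"
  shows "AE x\<in>{a<..<pi} in lebesgue. p x = 0 \<and> q x = 0"
proof -
  note a = assms(1)
  obtain N where "pi / a \<le> real N" using real_arch_simple by blast
  then have N: "pi \<le> real N * a" using a by (simp add: divide_le_eq)
  define r s where "r = potential_coeff a (- \<i>) p q" and "s = potential_coeff a \<i> p q"
  have r: "delay_coeff a r" and s: "delay_coeff a s"
    unfolding r_def s_def by (intro L2_on_imp_delay_coeff assms)+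
  define w v where "w lam = delay_wave a N r s (- \<i>) \<i> lam pi"
    and "v lam = delay_wave a N s r \<i> (- \<i>) (- lam) pi" for lam
  have C: "char_fun 1 a p q lam = (w lam + v lam) / 2" "char_fun 2 a p q lam = (w lam - v lam) / (2 * \<i>)" for lam
    using solS_pi[OF a N assms(3,4), of lam] by (simp_all add: char_fun_def w_def v_def r_def s_def)
  have seq: "eigenvalue_sequence j a p q (free_eigenvalue j)" if "j \<in> {1, 2}" for j
  proof -
    have "ev j = free_eigenvalue j" using assms(7)[OF that] by auto
    then show ?thesis using assms(6)[OF that] by simp
  qed
  define w' v' where "w' lam = w lam - (- \<i>) * exp (\<i> * lam * of_real pi)"
    and "v' lam = v lam - \<i> * exp (\<i> * (- lam) * of_real pi)" for lam
  have wh: "w holomorphic_on UNIV" unfolding w_def by (rule delay_wave_holomorphic[OF a r s])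
  have vh: "v holomorphic_on UNIV"
    using holomorphic_on_compose[OF holomorphic_on_minus[OF holomorphic_on_ident[of UNIV]]
        holomorphic_on_subset[OF delay_wave_holomorphic[OF a s r] subset_UNIV]]
    unfolding v_def comp_def .
  have hol: "w' holomorphic_on UNIV" "v' holomorphic_on UNIV"
    unfolding w'_def v'_def by (intro holomorphic_intros wh vh)+
  define K1 K2 where "K1 = (LINT t|lebesgue. norm (r t)) * picard_bound N r s (- \<i>) \<i>"
    and "K2 = (LINT t|lebesgue. norm (s t)) * picard_bound N s r \<i> (- \<i>)"
  define K where "K = max K1 K2"
  have K: "norm (w' lam) \<le> K * exp ((pi - a) * \<bar>Im lam\<bar>)" "norm (v' lam) \<le> K * exp ((pi - a) * \<bar>Im lam\<bar>)" for lam
  proof -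
    have "norm (w' lam) \<le> K1 * exp ((pi - a) * \<bar>Im lam\<bar>)"
      unfolding w'_def w_def K1_def by (rule norm_delay_wave_diff_le[OF a N r s])
    also have "\<dots> \<le> K * exp ((pi - a) * \<bar>Im lam\<bar>)" unfolding K_def by (intro mult_right_mono) auto
    finally show "norm (w' lam) \<le> K * exp ((pi - a) * \<bar>Im lam\<bar>)" .
    have "norm (v' lam) \<le> K2 * exp ((pi - a) * \<bar>Im lam\<bar>)"
      using norm_delay_wave_diff_le[OF a N s r, of \<i> "- \<i>" "- lam"] unfolding v'_def v_def K2_def by simp
    also have "\<dots> \<le> K * exp ((pi - a) * \<bar>Im lam\<bar>)" unfolding K_def by (intro mult_right_mono) auto
    finally show "norm (v' lam) \<le> K * exp ((pi - a) * \<bar>Im lam\<bar>)" .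
  qed
  \<comment> \<open>The free waves \<open>- \<i> * exp (\<i> * lam * pi)\<close> and
    \<open>\<i> * exp (- \<i> * lam * pi)\<close> combine to the sine and the negative cosine, so
    only the deviations \<open>w'\<close> and \<open>v'\<close> remain.\<close>
  have sin: "char_fun 1 a p q lam - sin (of_real pi * lam) = (w' lam + v' lam) / 2"
    and cos: "char_fun 2 a p q lam + cos (of_real pi * lam) = (w' lam - v' lam) / (2 * \<i>)" for lam
    unfolding C w'_def v'_def sin_exp_eq cos_exp_eq by (simp_all add: field_simps)
  have sum: "w' lam + v' lam = 0" for lam
  proof (rule entire_zero_on_integers_imp_zero[where k = a and C = "2 * K" and d = "\<lambda>z. w' z + v' z"])
    fix n :: int
    have "char_fun 1 a p q (of_int n) = 0"
      using char_fun_free_eigenvalue[OF seq[of 1], of n] by (simp add: free_eigenvalue_def)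
    moreover have "sin (of_real pi * of_int n :: complex) = 0" by (auto simp: sin_eq_0 mult.commute)
    ultimately show "w' (of_int n) + v' (of_int n) = 0" using sin[of "of_int n"] by simp
  next
    fix z
    show "norm (w' z + v' z) \<le> 2 * K * exp ((pi - a) * \<bar>Im z\<bar>)"
      using norm_triangle_ineq[of "w' z" "v' z"] K[of z] by simp
  qed (use a hol in \<open>auto intro!: holomorphic_intros\<close>)
  have diff: "w' lam - v' lam = 0" for lam
  proof -
    \<comment> \<open>The shift moves the zeros \<open>n - 1 / 2\<close> of the cosine to the
      integers; imaginary parts, and with them the growth bound, are unchanged.\<close>
    have "w' (z - 1 / 2) - v' (z - 1 / 2) = 0" for z
    proof (rule entire_zero_on_integers_imp_zero[where k = a and C = "2 * K" and d = "\<lambda>z. w' (z - 1 / 2) - v' (z - 1 / 2)"])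
      fix n :: int
      have "char_fun 2 a p q (of_int n - 1 / 2) = 0"
        using char_fun_free_eigenvalue[OF seq[of 2], of n] by (simp add: free_eigenvalue_def)
      moreover have "cos (of_real pi * (of_int n - 1 / 2) :: complex) = 0"
      proof -
        have "of_real pi * (of_int n - 1 / 2) = complex_of_real (of_int (n - 1) * pi) + of_real pi / 2"
          by (simp add: algebra_simps)
        then show ?thesis unfolding cos_eq_0 by blast
      qed
      ultimately show "w' (of_int n - 1 / 2) - v' (of_int n - 1 / 2) = 0" using cos[of "of_int n - 1 / 2"] by simp
    next
      fix z
      show "norm (w' (z - 1 / 2) - v' (z - 1 / 2)) \<le> 2 * K * exp ((pi - a) * \<bar>Im z\<bar>)"
        using norm_triangle_ineq4[of "w' (z - 1 / 2)" "v' (z - 1 / 2)"] K[of "z - 1 / 2"] by simp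
      have "(w' \<circ> (\<lambda>z. z - 1 / 2)) holomorphic_on UNIV" "(v' \<circ> (\<lambda>z. z - 1 / 2)) holomorphic_on UNIV"
        by (intro holomorphic_on_compose holomorphic_intros holomorphic_on_subset[OF hol(1)] holomorphic_on_subset[OF hol(2)] subset_UNIV)+
      then show "(\<lambda>z. w' (z - 1 / 2) - v' (z - 1 / 2)) holomorphic_on UNIV"
        unfolding comp_def by (rule holomorphic_on_diff)
    qed (rule a)
    from this[of "lam + 1 / 2"] show ?thesis by simp
  qed
  have "w' lam = 0 \<and> v' lam = 0" for lam
  proof -
    have "2 * w' lam = (w' lam + v' lam) + (w' lam - v' lam)" by simp
    then have "w' lam = 0" unfolding sum diff by simp
    then show ?thesis using sum[of lam] by simp
  qed
  moreover have "w' lam = exp (\<i> * lam * of_real pi) * (picard a N r s (- \<i>) \<i> lam pi + \<i>)"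
    "v' lam = exp (\<i> * (- lam) * of_real pi) * (picard a N s r \<i> (- \<i>) (- lam) pi - \<i>)" for lam
    by (simp_all add: w'_def v'_def w_def v_def delay_wave_def algebra_simps)
  ultimately have W: "picard a N r s (- \<i>) \<i> lam pi = - \<i>" and V: "picard a N s r \<i> (- \<i>) (- lam) pi = \<i>" for lam
    by (simp_all add: eq_neg_iff_add_eq_0)
  \<comment> \<open>The normalised wave ends at its initial value for every \<open>lam\<close>, so
    the integral term of the fixed point equation vanishes identically. The leading coefficient
    \<beta> is \<open>\<i>\<close> here and \<open>- \<i>\<close> for \<open>s\<close>.\<close>
  have "AE t in lebesgue. r t = 0"
  proof (rule picard_integral_zero_imp_AE_zero[OF a N r s])
    show "primitive (\<lambda>t. r t * (exp (- \<i> * lam * of_real (2 * t - a)) * picard a N s r \<i> (- \<i>) (- lam) (t - a))) pi = 0" for lam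
      using picard_fixed_point[OF a N r s order_refl, of "- \<i>" \<i> lam] unfolding W by (simp only: add_cancel_right_right)
  qed simp
  moreover have "AE t in lebesgue. s t = 0"
  proof (rule picard_integral_zero_imp_AE_zero[OF a N s r])
    show "primitive (\<lambda>t. s t * (exp (- \<i> * lam * of_real (2 * t - a)) * picard a N r s (- \<i>) \<i> (- lam) (t - a))) pi = 0" for lam
      using picard_fixed_point[OF a N s r order_refl, of \<i> "- \<i>" lam] V[of "- lam"]
      unfolding minus_minus by (simp only: add_cancel_right_right)
  qed simp
  ultimately show ?thesis
  proof eventually_elim
    case (elim x)
    show ?case
    proof
      assume "x \<in> {a<..<pi}"
      then have "q x - \<i> * p x = 0" "q x + \<i> * p x = 0"
        using elim by (auto simp: r_def s_def potential_coeff_def)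
      moreover have "2 * q x = (q x - \<i> * p x) + (q x + \<i> * p x)" by simp
      ultimately show "p x = 0 \<and> q x = 0" by simp
    qed
  qed
qed

end
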